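(* $\mathsf{ICM}$ has the amalgamation property: for all $\mathbf A,\mathbf B,\mathbf C\in\mathsf{ICM}$ and embeddings $h_1:\mathbf A\to\mathbf B$, $h_2:\mathbf A\to\mathbf C$, there exist $\mathbf D\in\mathsf{ICM}$ and embeddings $g_1:\mathbf B\to\mathbf D$, $g_2:\mathbf C\to\mathbf D$ with $g_1\circ h_1=g_2\circ h_2$.
   Context: A field is weakly rooted if it has characteristic $0$, or has prime characteristic $p$ and every element has a $p$-th root. Weak inverse: $a^*=a^{-1}$ if $a\ne0$, $0^*=0$. Weak $p$-root (in a weakly rooted field, $p$ prime): $r_p(a)=\sqrt[p]{a}$ if the characteristic is $p$, and $0$ otherwise. An implicitly closed field is a weakly rooted field (ring language $\{+,\cdot,-,0,1\}$) expanded by $(\,)^*$ and all $r_p$. $\mathsf{ICM}$ is the class of algebras in this language isomorphic to subalgebras of direct products of implicitly closed fields; embeddings are injective homomorphisms in this language. *)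

theory Defs
  imports Main "HOL-Library.FuncSet" "HOL-Computational_Algebra.Primes"
begin

text \<open>Algebras in the language of implicitly closed fields:
  ring operations + , * , unary minus, 0, 1, the weak inverse and the weak p-roots.
  The weak p-root operation is the component icroot applied to a prime p; its
  values at non-prime arguments are irrelevant (not part of the language).\<close>

record 'a icalg =
  icarrier :: "'a set"
  icadd :: "'a \<Rightarrow> 'a \<Rightarrow> 'a"
  icmul :: "'a \<Rightarrow> 'a \<Rightarrow> 'a"
  icneg :: "'a \<Rightarrow> 'a"
  iczero :: "'a"
  icone :: "'a"
  icinv :: "'a \<Rightarrow> 'a"
  icroot :: "nat \<Rightarrow> 'a \<Rightarrow> 'a"

definition ic_closed :: "'a icalg \<Rightarrow> 'a set \<Rightarrow> bool" where
  "ic_closed A S \<longleftrightarrow>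
     iczero A \<in> S \<and> icone A \<in> S \<and>
     (\<forall>x\<in>S. \<forall>y\<in>S. icadd A x y \<in> S \<and> icmul A x y \<in> S) \<and>
     (\<forall>x\<in>S. icneg A x \<in> S \<and> icinv A x \<in> S) \<and>
     (\<forall>p x. prime p \<longrightarrow> x \<in> S \<longrightarrow> icroot A p x \<in> S)"

definition ic_algebra :: "'a icalg \<Rightarrow> bool" where
  "ic_algebra A \<longleftrightarrow> ic_closed A (icarrier A)"

definition ic_subalgebra :: "'a set \<Rightarrow> 'a icalg \<Rightarrow> bool" where
  "ic_subalgebra S P \<longleftrightarrow> S \<subseteq> icarrier P \<and> ic_closed P S"

definition ic_hom :: "'a icalg \<Rightarrow> 'b icalg \<Rightarrow> ('a \<Rightarrow> 'b) \<Rightarrow> bool" where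
  "ic_hom A B h \<longleftrightarrow>
     (\<forall>x\<in>icarrier A. h x \<in> icarrier B) \<and>
     h (iczero A) = iczero B \<and> h (icone A) = icone B \<and>
     (\<forall>x\<in>icarrier A. \<forall>y\<in>icarrier A.
        h (icadd A x y) = icadd B (h x) (h y) \<and> h (icmul A x y) = icmul B (h x) (h y)) \<and>
     (\<forall>x\<in>icarrier A. h (icneg A x) = icneg B (h x) \<and> h (icinv A x) = icinv B (h x)) \<and>
     (\<forall>p. prime p \<longrightarrow> (\<forall>x\<in>icarrier A. h (icroot A p x) = icroot B p (h x)))"

definition ic_embedding :: "'a icalg \<Rightarrow> 'b icalg \<Rightarrow> ('a \<Rightarrow> 'b) \<Rightarrow> bool" where
  "ic_embedding A B h \<longleftrightarrow> ic_hom A B h \<and> inj_on h (icarrier A)"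

fun ic_natone :: "'a icalg \<Rightarrow> nat \<Rightarrow> 'a" where
  "ic_natone F 0 = iczero F"
| "ic_natone F (Suc n) = icadd F (ic_natone F n) (icone F)"

fun ic_pow :: "'a icalg \<Rightarrow> 'a \<Rightarrow> nat \<Rightarrow> 'a" where
  "ic_pow F x 0 = icone F"
| "ic_pow F x (Suc n) = icmul F (ic_pow F x n) x"

definition ic_field :: "'a icalg \<Rightarrow> bool" where
  "ic_field F \<longleftrightarrow>
     iczero F \<in> icarrier F \<and> icone F \<in> icarrier F \<and>
     (\<forall>x\<in>icarrier F. \<forall>y\<in>icarrier F. icadd F x y \<in> icarrier F \<and> icmul F x y \<in> icarrier F) \<and>
     (\<forall>x\<in>icarrier F. icneg F x \<in> icarrier F) \<and>
     (\<forall>x\<in>icarrier F. \<forall>y\<in>icarrier F. \<forall>z\<in>icarrier F.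
        icadd F (icadd F x y) z = icadd F x (icadd F y z) \<and>
        icmul F (icmul F x y) z = icmul F x (icmul F y z) \<and>
        icmul F x (icadd F y z) = icadd F (icmul F x y) (icmul F x z)) \<and>
     (\<forall>x\<in>icarrier F. \<forall>y\<in>icarrier F. icadd F x y = icadd F y x \<and> icmul F x y = icmul F y x) \<and>
     (\<forall>x\<in>icarrier F. icadd F x (iczero F) = x \<and> icadd F x (icneg F x) = iczero F \<and>
        icmul F x (icone F) = x) \<and>
     iczero F \<noteq> icone F \<and>
     (\<forall>x\<in>icarrier F. x \<noteq> iczero F \<longrightarrow> (\<exists>y\<in>icarrier F. icmul F x y = icone F))"

definition ic_char0 :: "'a icalg \<Rightarrow> bool" where
  "ic_char0 F \<longleftrightarrow> (\<forall>n>0. ic_natone F n \<noteq> iczero F)"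

definition ic_charp :: "'a icalg \<Rightarrow> nat \<Rightarrow> bool" where
  "ic_charp F p \<longleftrightarrow> prime p \<and> ic_natone F p = iczero F"

definition weakly_rooted :: "'a icalg \<Rightarrow> bool" where
  "weakly_rooted F \<longleftrightarrow> ic_field F \<and>
     (ic_char0 F \<or>
      (\<exists>p. ic_charp F p \<and> (\<forall>a\<in>icarrier F. \<exists>b\<in>icarrier F. ic_pow F b p = a)))"

definition implicitly_closed_field :: "'a icalg \<Rightarrow> bool" where
  "implicitly_closed_field F \<longleftrightarrow> weakly_rooted F \<and>
     (\<forall>a\<in>icarrier F. icinv F a \<in> icarrier F \<and>
        (a = iczero F \<longrightarrow> icinv F a = iczero F) \<and>
        (a \<noteq> iczero F \<longrightarrow> icmul F a (icinv F a) = icone F)) \<and>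
     (\<forall>p. prime p \<longrightarrow> (\<forall>a\<in>icarrier F. icroot F p a \<in> icarrier F \<and>
        (if ic_charp F p then ic_pow F (icroot F p a) p = a else icroot F p a = iczero F)))"

definition ic_product :: "'i set \<Rightarrow> ('i \<Rightarrow> 'f icalg) \<Rightarrow> ('i \<Rightarrow> 'f) icalg" where
  "ic_product I F =
     \<lparr> icarrier = PiE I (\<lambda>i. icarrier (F i)),
       icadd = (\<lambda>x y. \<lambda>i\<in>I. icadd (F i) (x i) (y i)),
       icmul = (\<lambda>x y. \<lambda>i\<in>I. icmul (F i) (x i) (y i)),
       icneg = (\<lambda>x. \<lambda>i\<in>I. icneg (F i) (x i)),
       iczero = (\<lambda>i\<in>I. iczero (F i)),
       icone = (\<lambda>i\<in>I. icone (F i)),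
       icinv = (\<lambda>x. \<lambda>i\<in>I. icinv (F i) (x i)),
       icroot = (\<lambda>p x. \<lambda>i\<in>I. icroot (F i) p (x i)) \<rparr>"

text \<open>A belongs to ICM, witnessed by a product indexed by a set of type 'i of
  implicitly closed fields carried by type 'f: A is (an algebra) isomorphic to a
  subalgebra of such a direct product.\<close>
definition ICM :: "'a icalg \<Rightarrow> 'i itself \<Rightarrow> 'f itself \<Rightarrow> bool" where
  "ICM A (_::'i itself) (_::'f itself) \<longleftrightarrow> ic_algebra A \<and>
     (\<exists>(I::'i set) (F::'i \<Rightarrow> 'f icalg) S h.
        (\<forall>i\<in>I. implicitly_closed_field (F i)) \<and>
        ic_subalgebra S (ic_product I F) \<and>
        ic_hom A (ic_product I F) h \<and> bij_betw h (icarrier A) S)"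

end

(* The problem is local: it suffices to find, for each nonzero b in B (and symmetrically in C), a
   field F with homomorphisms B -> F <- C that agree on A and do not kill b. The product of these
   fields receives B and C injectively, and the subalgebra generated by their images is the amalgam.
   For a single b, let e be the idempotent b b*. Since A is von Neumann regular, e does not vanish in
   B tensor_A C, so some maximal ideal contains 1 - e, and b is nonzero in its residue field. In
   characteristic p this field is perfect, because as a ring it is generated by the images of B and C,
   which consist of p-th powers. Ring homomorphisms from B and C to it preserve weak inverses and weak
   p-roots, since these are determined by equations and p-th roots in characteristic p are unique. *)
theory Submission
  imports Defs "HOL-Algebra.QuotRing" "HOL-Algebra.Generated_Rings"
begin

section \<open>Submodules, maximal ideals and endomorphism rings\<close>

text \<open>No tensor product is built. \<open>B\<close> and \<open>C\<close> act by commuting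
  operators on the group Hom_A(B, C/J), and the ring that these operators generate takes its place.
  For \<open>e\<close> to act as a nonzero operator, one \<open>A\<close>-linear map that does not
  vanish at \<open>e\<close> is enough. Here regularity of \<open>A\<close> does the work of
  flatness. Let \<open>H\<close> be a submodule of \<open>B\<close> maximal among those avoiding
  \<open>e\<close>, and P = {a. a e in H}. Regularity makes B/H isomorphic to A/P and, together with
  injectivity of \<open>A\<close> into \<open>C\<close>, keeps the ideal J of \<open>C\<close>
  generated by P proper. The composite B -> B/H = A/P -> C/J is the map wanted. The other obstacle
  is size. The theorem places \<open>D\<close>, the index set and the fields all on
  \<open>('b + 'c) list\<close>, whereas the elements of the residue fields are sets of operators,
  of a type that depends on the order of \<open>B\<close> and \<open>C\<close>. Each field is
  therefore cut down to the subalgebra generated by the two images. Closed under weak inverses and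
  weak roots, it is again an implicitly closed field, and its elements are values of terms over
  \<open>'b + 'c\<close>, which lists can encode. The same device moves the amalgam to the required
  type.\<close>

definition hom_submodule ::
  "('a, 'm) ring_scheme \<Rightarrow> ('b, 'n) ring_scheme \<Rightarrow> ('a \<Rightarrow> 'b) \<Rightarrow> 'b set \<Rightarrow> bool" where
  "hom_submodule A B h H \<longleftrightarrow> H \<subseteq> carrier B \<and> \<zero>\<^bsub>B\<^esub> \<in> H \<and>
     (\<forall>x\<in>H. \<forall>y\<in>H. x \<oplus>\<^bsub>B\<^esub> y \<in> H) \<and> (\<forall>a\<in>carrier A. \<forall>x\<in>H. h a \<otimes>\<^bsub>B\<^esub> x \<in> H)"

lemma hom_submoduleD:
  assumes "hom_submodule A B h H"
  shows "x \<in> H \<Longrightarrow> x \<in> carrier B" "\<zero>\<^bsub>B\<^esub> \<in> H"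
    "x \<in> H \<Longrightarrow> y \<in> H \<Longrightarrow> x \<oplus>\<^bsub>B\<^esub> y \<in> H"
    "a \<in> carrier A \<Longrightarrow> x \<in> H \<Longrightarrow> h a \<otimes>\<^bsub>B\<^esub> x \<in> H"
  using assms by (auto simp: hom_submodule_def)

lemma hom_submodule_Union_chain:
  assumes "\<C> \<noteq> {}" "\<And>X. X \<in> \<C> \<Longrightarrow> hom_submodule A B h X"
    and chain: "\<And>X Y. X \<in> \<C> \<Longrightarrow> Y \<in> \<C> \<Longrightarrow> X \<subseteq> Y \<or> Y \<subseteq> X"
  shows "hom_submodule A B h (\<Union>\<C>)"
  unfolding hom_submodule_def
proof (intro conjI ballI)
  show "\<Union>\<C> \<subseteq> carrier B" "\<zero>\<^bsub>B\<^esub> \<in> \<Union>\<C>"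
    using assms hom_submoduleD(1,2) by fast+
next
  fix x y assume "x \<in> \<Union>\<C>" "y \<in> \<Union>\<C>"
  then obtain X Y where XY: "X \<in> \<C>" "Y \<in> \<C>" "x \<in> X" "y \<in> Y" by blast
  then obtain Z where "Z \<in> \<C>" "x \<in> Z" "y \<in> Z" using chain by (meson subsetD)
  then show "x \<oplus>\<^bsub>B\<^esub> y \<in> \<Union>\<C>" using assms(2) hom_submoduleD(3) by fast
next
  fix a x assume "a \<in> carrier A" "x \<in> \<Union>\<C>"
  then show "h a \<otimes>\<^bsub>B\<^esub> x \<in> \<Union>\<C>" using assms(2) hom_submoduleD(4) by fast
qed

text \<open>Zorn's lemma, stated so as to serve twice: for \<open>A\<close>-submodules of
  \<open>B\<close> that avoid a given element and, with \<open>A = B\<close> and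
  \<open>h = id\<close>, for proper ideals.\<close>

lemma exists_maximal_hom_submodule:
  assumes "hom_submodule A B h H0" "e \<notin> H0"
  obtains H where "hom_submodule A B h H" "H0 \<subseteq> H" "e \<notin> H"
    "\<And>H'. hom_submodule A B h H' \<Longrightarrow> H \<subseteq> H' \<Longrightarrow> e \<notin> H' \<Longrightarrow> H' = H"
proof -
  let ?S = "{H. hom_submodule A B h H \<and> H0 \<subseteq> H \<and> e \<notin> H}"
  have "\<exists>M\<in>?S. \<forall>X\<in>?S. M \<subseteq> X \<longrightarrow> X = M"
  proof (rule subset_Zorn_nonempty)
    show "?S \<noteq> {}" using assms by blast
  next
    fix \<C> assume ne: "\<C> \<noteq> {}" and ch: "subset.chain ?S \<C>"
    have "hom_submodule A B h (\<Union>\<C>)"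
      using ne ch by (intro hom_submodule_Union_chain) (auto simp: subset_chain_def)
    moreover have "H0 \<subseteq> \<Union>\<C>" "e \<notin> \<Union>\<C>"
      using ne ch by (fastforce simp: subset_chain_def)+
    ultimately show "\<Union>\<C> \<in> ?S" by blast
  qed
  then obtain M where M: "M \<in> ?S" "\<forall>X\<in>?S. M \<subseteq> X \<longrightarrow> X = M" by blast
  have "H' = M" if "hom_submodule A B h H'" "M \<subseteq> H'" "e \<notin> H'" for H'
    using M that by blast
  then show ?thesis using that[of M] M(1) by blast
qed

text \<open>\<open>H + A x\<close> is a submodule strictly above \<open>H\<close>, so maximality
  forces it to contain \<open>e\<close>.\<close>

lemma maximal_hom_submodule_extend:
  assumes "ring A" "cring B" "h \<in> ring_hom A B" and H: "hom_submodule A B h H"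
    and max: "\<And>H'. hom_submodule A B h H' \<Longrightarrow> H \<subseteq> H' \<Longrightarrow> e \<notin> H' \<Longrightarrow> H' = H"
    and x: "x \<in> carrier B" "x \<notin> H"
  shows "\<exists>k\<in>H. \<exists>a\<in>carrier A. e = k \<oplus>\<^bsub>B\<^esub> h a \<otimes>\<^bsub>B\<^esub> x"
proof (rule ccontr)
  interpret A: ring A by fact
  interpret B: cring B by fact
  interpret h: ring_hom_ring A B h
    using assms by (intro ring_hom_ringI2) (auto intro: cring.axioms)
  assume neg: "\<not> ?thesis"
  define H' where "H' = {k \<oplus>\<^bsub>B\<^esub> h a \<otimes>\<^bsub>B\<^esub> x |k a. k \<in> H \<and> a \<in> carrier A}"
  note HD = hom_submoduleD[OF H]
  have "hom_submodule A B h H'"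
    unfolding hom_submodule_def
  proof (intro conjI ballI)
    show "H' \<subseteq> carrier B" using x HD(1) by (auto simp: H'_def)
    have "\<zero>\<^bsub>B\<^esub> = \<zero>\<^bsub>B\<^esub> \<oplus>\<^bsub>B\<^esub> h \<zero>\<^bsub>A\<^esub> \<otimes>\<^bsub>B\<^esub> x" using x by simp
    then show "\<zero>\<^bsub>B\<^esub> \<in> H'" unfolding H'_def using HD(2) by blast
  next
    fix y z assume "y \<in> H'" "z \<in> H'"
    then obtain k a l b where *: "k \<in> H" "a \<in> carrier A" "y = k \<oplus>\<^bsub>B\<^esub> h a \<otimes>\<^bsub>B\<^esub> x"
      "l \<in> H" "b \<in> carrier A" "z = l \<oplus>\<^bsub>B\<^esub> h b \<otimes>\<^bsub>B\<^esub> x" unfolding H'_def by blast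
    have c: "k \<in> carrier B" "l \<in> carrier B" "h a \<in> carrier B" "h b \<in> carrier B"
      using * HD(1) by auto
    have "y \<oplus>\<^bsub>B\<^esub> z = (k \<oplus>\<^bsub>B\<^esub> l) \<oplus>\<^bsub>B\<^esub> h (a \<oplus>\<^bsub>A\<^esub> b) \<otimes>\<^bsub>B\<^esub> x"
      unfolding *(3,6) h.hom_add[OF *(2,5)] using c x(1) by algebra
    then show "y \<oplus>\<^bsub>B\<^esub> z \<in> H'" unfolding H'_def using * HD(3) by blast
  next
    fix b y assume b: "b \<in> carrier A" and "y \<in> H'"
    then obtain k a where *: "k \<in> H" "a \<in> carrier A" "y = k \<oplus>\<^bsub>B\<^esub> h a \<otimes>\<^bsub>B\<^esub> x"
      unfolding H'_def by blast
    have c: "k \<in> carrier B" "h a \<in> carrier B" "h b \<in> carrier B"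
      using * b HD(1) by auto
    have "h b \<otimes>\<^bsub>B\<^esub> y = (h b \<otimes>\<^bsub>B\<^esub> k) \<oplus>\<^bsub>B\<^esub> h (b \<otimes>\<^bsub>A\<^esub> a) \<otimes>\<^bsub>B\<^esub> x"
      unfolding *(3) h.hom_mult[OF b *(2)] using c x(1) by algebra
    then show "h b \<otimes>\<^bsub>B\<^esub> y \<in> H'" unfolding H'_def using * b HD(4) by blast
  qed
  moreover have "H \<subseteq> H'"
  proof
    fix k assume k: "k \<in> H"
    then have "k = k \<oplus>\<^bsub>B\<^esub> h \<zero>\<^bsub>A\<^esub> \<otimes>\<^bsub>B\<^esub> x" using x HD(1) by simp
    then show "k \<in> H'" unfolding H'_def using k by blast
  qed
  moreover have "e \<notin> H'" using neg unfolding H'_def by blast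
  ultimately have "H' = H" by (rule max)
  moreover have "x = \<zero>\<^bsub>B\<^esub> \<oplus>\<^bsub>B\<^esub> h \<one>\<^bsub>A\<^esub> \<otimes>\<^bsub>B\<^esub> x" using x by simp
  then have "x \<in> H'" unfolding H'_def using HD(2) by blast
  ultimately show False using x by blast
qed

text \<open>Ideals are the submodules for \<open>h = id\<close>, closure under negation coming from
  the scalar -1, and the proper ones are those that avoid 1.\<close>

lemma (in cring) exists_maximalideal:
  assumes I: "ideal I R" and one: "\<one> \<notin> I"
  obtains M where "maximalideal M R" "I \<subseteq> M"
proof -
  have sub: "hom_submodule R R id J \<longleftrightarrow> ideal J R" for J
  proof
    assume J: "hom_submodule R R id J"
    note JD = hom_submoduleD[OF J, unfolded id_apply]
    have neg: "\<ominus> x \<in> J" if "x \<in> J" for x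
    proof -
      have "\<ominus> x = (\<ominus> \<one>) \<otimes> x" using JD(1)[OF that] by algebra
      then show ?thesis using JD(4)[of "\<ominus> \<one>" x] that by simp
    qed
    show "ideal J R"
    proof (rule idealI[OF ring_axioms])
      show "subgroup J (add_monoid R)"
        using JD neg by unfold_locales (auto simp: a_inv_def[symmetric])
      show "x \<otimes> a \<in> J" "a \<otimes> x \<in> J" if "a \<in> J" "x \<in> carrier R" for a x
        using that JD(4)[OF that(2,1)] JD(1)[OF that(1)] by (auto simp: m_comm)
    qed
  next
    assume "ideal J R"
    then interpret J: ideal J R .
    show "hom_submodule R R id J"
      using J.a_subset J.zero_closed J.a_closed J.I_l_closed by (auto simp: hom_submodule_def)
  qed
  obtain M where M: "hom_submodule R R id M" "I \<subseteq> M" "\<one> \<notin> M"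
    "\<And>H'. hom_submodule R R id H' \<Longrightarrow> M \<subseteq> H' \<Longrightarrow> \<one> \<notin> H' \<Longrightarrow> H' = M"
    using exists_maximal_hom_submodule[of R R id I "\<one>"] I one sub by blast
  have "maximalideal M R"
  proof (rule maximalidealI)
    show "ideal M R" using M(1) sub by blast
    show "carrier R \<noteq> M" using M(3) one_closed by blast
    show "J = M \<or> J = carrier R" if "ideal J R" "M \<subseteq> J" "J \<subseteq> carrier R" for J
      using M(4)[of J] that sub ideal.one_imp_carrier[of J R] by blast
  qed
  then show ?thesis using that M(2) by blast
qed

text \<open>Operators form a noncommutative ring, while residue fields require a commutative one.
  Centralizers are subrings, so commutation of generators spreads to everything they
  generate.\<close>

lemma (in ring) generate_ring_cring:
  assumes G: "G \<subseteq> carrier R" and comm: "\<And>x y. x \<in> G \<Longrightarrow> y \<in> G \<Longrightarrow> x \<otimes> y = y \<otimes> x"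
  shows "cring (R \<lparr> carrier := generate_ring R G \<rparr>)"
proof -
  have centralizer: "subring {x \<in> carrier R. \<forall>y\<in>S. x \<otimes> y = y \<otimes> x} R" if "S \<subseteq> carrier R" for S
  proof (rule subringI)
    fix x y assume "x \<in> {x \<in> carrier R. \<forall>y\<in>S. x \<otimes> y = y \<otimes> x}"
      "y \<in> {x \<in> carrier R. \<forall>y\<in>S. x \<otimes> y = y \<otimes> x}"
    then show "x \<otimes> y \<in> {x \<in> carrier R. \<forall>y\<in>S. x \<otimes> y = y \<otimes> x}"
      "x \<oplus> y \<in> {x \<in> carrier R. \<forall>y\<in>S. x \<otimes> y = y \<otimes> x}"
      using that by (auto simp: l_distr r_distr subset_iff) (metis m_assoc)+
  qed (use that in \<open>auto simp: l_minus r_minus subset_iff\<close>)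
  \<comment> \<open>Two passes: \<open>G\<close> lies in its own centralizer, hence so does the ring
    it generates. Thus \<open>G\<close> centralizes that ring, and the second pass replaces
    \<open>G\<close> by the whole ring on the left as well.\<close>
  have "generate_ring R G \<subseteq> {x \<in> carrier R. \<forall>y\<in>G. x \<otimes> y = y \<otimes> x}"
    using G comm by (intro generate_ring_min_subring1 centralizer) auto
  then have "generate_ring R G \<subseteq> {x \<in> carrier R. \<forall>y\<in>generate_ring R G. x \<otimes> y = y \<otimes> x}"
    by (intro generate_ring_min_subring1[OF G centralizer[OF generate_ring_incl[OF G]]])
      (use G in fastforce)
  then have "\<And>x y. x \<in> generate_ring R G \<Longrightarrow> y \<in> generate_ring R G \<Longrightarrow> x \<otimes> y = y \<otimes> x"
    by blast
  then show ?thesis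
    using generate_ring_is_subring[OF G] subcring_iff[OF generate_ring_incl[OF G]]
    by (simp add: subcringI)
qed

text \<open>Additive endomorphisms under composition. They are taken extensional, so that operators
  agreeing on \<open>carrier V\<close> are equal as functions.\<close>

definition End_ring :: "('v, 'm) ring_scheme \<Rightarrow> ('v \<Rightarrow> 'v) ring" where
  "End_ring V = \<lparr> carrier = {T \<in> carrier V \<rightarrow>\<^sub>E carrier V.
       \<forall>f\<in>carrier V. \<forall>g\<in>carrier V. T (f \<oplus>\<^bsub>V\<^esub> g) = T f \<oplus>\<^bsub>V\<^esub> T g},
     monoid.mult = (\<lambda>S T. \<lambda>f\<in>carrier V. S (T f)), one = (\<lambda>f\<in>carrier V. f),
     zero = (\<lambda>f\<in>carrier V. \<zero>\<^bsub>V\<^esub>), add = (\<lambda>S T. \<lambda>f\<in>carrier V. S f \<oplus>\<^bsub>V\<^esub> T f) \<rparr>"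

lemma ring_End_ring:
  assumes "abelian_group V" shows "ring (End_ring V)"
proof -
  interpret V: abelian_group V by fact
  have memI: "T \<in> carrier (End_ring V)" if "T \<in> carrier V \<rightarrow>\<^sub>E carrier V"
    "\<And>f g. f \<in> carrier V \<Longrightarrow> g \<in> carrier V \<Longrightarrow> T (f \<oplus>\<^bsub>V\<^esub> g) = T f \<oplus>\<^bsub>V\<^esub> T g" for T
    using that by (simp add: End_ring_def)
  have memD: "f \<in> carrier V \<Longrightarrow> T f \<in> carrier V" "T \<in> extensional (carrier V)"
    "f \<in> carrier V \<Longrightarrow> g \<in> carrier V \<Longrightarrow> T (f \<oplus>\<^bsub>V\<^esub> g) = T f \<oplus>\<^bsub>V\<^esub> T g"
    if "T \<in> carrier (End_ring V)" for T f g
    using that by (auto simp: End_ring_def PiE_def)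
  have ext: "S = T" if "S \<in> carrier (End_ring V)" "T \<in> carrier (End_ring V)"
    "\<And>f. f \<in> carrier V \<Longrightarrow> S f = T f" for S T
    using that memD(2) by (meson extensionalityI)
  have z: "T \<zero>\<^bsub>V\<^esub> = \<zero>\<^bsub>V\<^esub>" if "T \<in> carrier (End_ring V)" for T
  proof -
    have "T \<zero>\<^bsub>V\<^esub> \<oplus>\<^bsub>V\<^esub> T \<zero>\<^bsub>V\<^esub> = T \<zero>\<^bsub>V\<^esub>" using memD(3)[OF that, of "\<zero>\<^bsub>V\<^esub>" "\<zero>\<^bsub>V\<^esub>"] by simp
    then show ?thesis using memD(1)[OF that V.zero_closed] V.add.l_cancel_one' by metis
  qed
  have add: "S \<oplus>\<^bsub>End_ring V\<^esub> T \<in> carrier (End_ring V)"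
    if "S \<in> carrier (End_ring V)" "T \<in> carrier (End_ring V)" for S T
    using memD[OF that(1)] memD[OF that(2)]
    by (intro memI) (auto simp: End_ring_def V.a_ac)
  have mul: "S \<otimes>\<^bsub>End_ring V\<^esub> T \<in> carrier (End_ring V)"
    if "S \<in> carrier (End_ring V)" "T \<in> carrier (End_ring V)" for S T
    using memD[OF that(1)] memD[OF that(2)] by (intro memI) (auto simp: End_ring_def)
  have zero: "\<zero>\<^bsub>End_ring V\<^esub> \<in> carrier (End_ring V)" by (intro memI) (auto simp: End_ring_def)
  have one: "\<one>\<^bsub>End_ring V\<^esub> \<in> carrier (End_ring V)" by (intro memI) (auto simp: End_ring_def)
  have neg: "(\<lambda>f\<in>carrier V. \<ominus>\<^bsub>V\<^esub> T f) \<in> carrier (End_ring V)" if "T \<in> carrier (End_ring V)" for T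
    using memD[OF that] by (intro memI) (auto simp: V.minus_add)
  have ap: "\<And>S T f. f \<in> carrier V \<Longrightarrow> (S \<oplus>\<^bsub>End_ring V\<^esub> T) f = S f \<oplus>\<^bsub>V\<^esub> T f"
    "\<And>S T f. f \<in> carrier V \<Longrightarrow> (S \<otimes>\<^bsub>End_ring V\<^esub> T) f = S (T f)"
    "\<And>f. f \<in> carrier V \<Longrightarrow> \<zero>\<^bsub>End_ring V\<^esub> f = \<zero>\<^bsub>V\<^esub>"
    "\<And>f. f \<in> carrier V \<Longrightarrow> \<one>\<^bsub>End_ring V\<^esub> f = f"
    by (auto simp: End_ring_def)
  show ?thesis
  proof (rule ringI)
    show "abelian_group (End_ring V)"
    proof (rule abelian_groupI)
      fix T assume T: "T \<in> carrier (End_ring V)"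
      have "(\<lambda>f\<in>carrier V. \<ominus>\<^bsub>V\<^esub> T f) \<oplus>\<^bsub>End_ring V\<^esub> T = \<zero>\<^bsub>End_ring V\<^esub>"
        using T memD(1)[OF T] by (intro ext add neg zero) (auto simp: ap V.l_neg)
      then show "\<exists>S\<in>carrier (End_ring V). S \<oplus>\<^bsub>End_ring V\<^esub> T = \<zero>\<^bsub>End_ring V\<^esub>"
        using neg[OF T] by blast
    qed (auto intro!: ext add zero simp: ap V.a_ac memD(1))
    show "Group.monoid (End_ring V)"
      by (rule monoidI) (auto intro!: ext mul one simp: ap memD(1))
  qed (auto intro!: ext add mul simp: ap memD)
qed

section \<open>Amalgamating two algebras over a regular ring in a field\<close>

text \<open>A maximal \<open>A\<close>-submodule \<open>H\<close> of \<open>B\<close> avoiding \<open>e\<close> satisfies \<open>B = H + A e\<close>, so reading off the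
  coefficient of \<open>e\<close> is a functional with values modulo \<open>{a. a e \<in> H}\<close>. Regularity of \<open>A\<close> keeps the
  ideal that this set generates in \<open>C\<close> proper.\<close>
lemma exists_functional:
  assumes "cring A" "cring B" "cring C"
    and reg: "\<And>a. a \<in> carrier A \<Longrightarrow> \<exists>a'\<in>carrier A. a \<otimes>\<^bsub>A\<^esub> a' \<otimes>\<^bsub>A\<^esub> a = a"
    and "h1 \<in> ring_hom A B" "h2 \<in> ring_hom A C" and inj: "inj_on h2 (carrier A)"
    and e: "e \<in> carrier B" "e \<noteq> \<zero>\<^bsub>B\<^esub>"
  obtains J f where "ideal J C" "f \<in> carrier B \<rightarrow> carrier (C Quot J)"
    "\<And>x y. x \<in> carrier B \<Longrightarrow> y \<in> carrier B \<Longrightarrow> f (x \<oplus>\<^bsub>B\<^esub> y) = f x \<oplus>\<^bsub>C Quot J\<^esub> f y"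
    "\<And>a x. a \<in> carrier A \<Longrightarrow> x \<in> carrier B \<Longrightarrow>
       f (h1 a \<otimes>\<^bsub>B\<^esub> x) = (J +>\<^bsub>C\<^esub> h2 a) \<otimes>\<^bsub>C Quot J\<^esub> f x"
    "f e \<noteq> \<zero>\<^bsub>C Quot J\<^esub>"
proof -
  interpret A: cring A by fact
  interpret B: cring B by fact
  interpret C: cring C by fact
  interpret h1: ring_hom_cring A B h1
    using assms by (intro ring_hom_cringI ring_hom_ringI2 A.ring_axioms B.ring_axioms)
  interpret h2: ring_hom_cring A C h2
    using assms by (intro ring_hom_cringI ring_hom_ringI2 A.ring_axioms C.ring_axioms)
  have "hom_submodule A B h1 {\<zero>\<^bsub>B\<^esub>}" by (auto simp: hom_submodule_def)
  moreover have "e \<notin> {\<zero>\<^bsub>B\<^esub>}" using e by simp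
  ultimately obtain H where H: "hom_submodule A B h1 H" and eH: "e \<notin> H"
    and max: "\<And>H'. hom_submodule A B h1 H' \<Longrightarrow> H \<subseteq> H' \<Longrightarrow> e \<notin> H' \<Longrightarrow> H' = H"
    by (rule exists_maximal_hom_submodule) blast
  note HD = hom_submoduleD[OF H]
  have ext: "\<exists>k\<in>H. \<exists>a\<in>carrier A. e = k \<oplus>\<^bsub>B\<^esub> h1 a \<otimes>\<^bsub>B\<^esub> x"
    if "x \<in> carrier B" "x \<notin> H" for x
    using A.ring_axioms B.is_cring h1.homh H max that by (rule maximal_hom_submodule_extend)
  have negH: "\<ominus>\<^bsub>B\<^esub> x \<in> H" if "x \<in> H" for x
  proof -
    have "\<ominus>\<^bsub>B\<^esub> x = h1 (\<ominus>\<^bsub>A\<^esub> \<one>\<^bsub>A\<^esub>) \<otimes>\<^bsub>B\<^esub> x"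
      using HD(1)[OF that] by (simp add: B.l_minus)
    then show ?thesis using HD(4)[OF _ that, of "\<ominus>\<^bsub>A\<^esub> \<one>\<^bsub>A\<^esub>"] by simp
  qed
  have diffH: "x \<ominus>\<^bsub>B\<^esub> y \<in> H" if "x \<in> H" "y \<in> H" for x y
    using that negH HD(3) by (simp add: B.minus_eq)
  \<comment> \<open>The annihilator of \<open>e\<close> modulo \<open>H\<close>: two coefficients of
    \<open>e\<close> for the same element of \<open>B\<close> modulo \<open>H\<close> differ by a
    member of \<open>P\<close>.\<close>
  define P where "P = {a \<in> carrier A. h1 a \<otimes>\<^bsub>B\<^esub> e \<in> H}"
  have PA: "a \<in> carrier A" if "a \<in> P" for a using that by (simp add: P_def)
  have Pmult: "b \<otimes>\<^bsub>A\<^esub> a \<in> P" if "a \<in> P" "b \<in> carrier A" for a b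
    using that HD(4)[of b "h1 a \<otimes>\<^bsub>B\<^esub> e"] e by (auto simp: P_def B.m_assoc)
  have Padd: "a \<oplus>\<^bsub>A\<^esub> b \<in> P" if "a \<in> P" "b \<in> P" for a b
    using that HD(3)[of "h1 a \<otimes>\<^bsub>B\<^esub> e" "h1 b \<otimes>\<^bsub>B\<^esub> e"] e by (auto simp: P_def B.l_distr)
  have P1: "\<one>\<^bsub>A\<^esub> \<notin> P" using eH e by (simp add: P_def)
  have P0: "\<zero>\<^bsub>A\<^esub> \<in> P" using HD(2) e by (simp add: P_def)
  define J where "J = {c \<in> carrier C. \<exists>f\<in>P. c = h2 f \<otimes>\<^bsub>C\<^esub> c}"
  have JP: "h2 a \<in> J" if a: "a \<in> P" for a
  proof -
    obtain a' where a': "a' \<in> carrier A" "a \<otimes>\<^bsub>A\<^esub> a' \<otimes>\<^bsub>A\<^esub> a = a" using reg[OF PA[OF a]] by blast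
    \<comment> \<open>The idempotent \<open>a' a\<close> is in \<open>P\<close> and fixes
      \<open>a\<close>, so it is the witness for \<open>h2 a\<close>.\<close>
    have "h2 (a' \<otimes>\<^bsub>A\<^esub> a) \<otimes>\<^bsub>C\<^esub> h2 a = h2 (a' \<otimes>\<^bsub>A\<^esub> a \<otimes>\<^bsub>A\<^esub> a)" using a' PA[OF a] by simp
    also have "a' \<otimes>\<^bsub>A\<^esub> a \<otimes>\<^bsub>A\<^esub> a = a" using a' PA[OF a] A.m_comm by metis
    finally show ?thesis 
      unfolding J_def using Pmult[OF a a'(1)] PA[OF a] by (auto intro!: bexI[of _ "a' \<otimes>\<^bsub>A\<^esub> a"])
  qed
  have Jid: "ideal J C"
  proof (rule idealI[OF C.ring_axioms])
    show "subgroup J (add_monoid C)"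
    proof (rule C.add.subgroupI)
      show "J \<subseteq> carrier C" by (auto simp: J_def)
      show "J \<noteq> {}" using JP P0 by blast
      show "\<ominus>\<^bsub>C\<^esub> c \<in> J" if "c \<in> J" for c
        using that PA unfolding J_def by clarsimp (metis C.r_minus h2.hom_closed)
      show "c \<oplus>\<^bsub>C\<^esub> d \<in> J" if cd: "c \<in> J" "d \<in> J" for c d
      proof -
        obtain f g where fg: "f \<in> P" "g \<in> P" "c = h2 f \<otimes>\<^bsub>C\<^esub> c" "d = h2 g \<otimes>\<^bsub>C\<^esub> d"
          using cd unfolding J_def by blast
        have c: "c \<in> carrier C" "d \<in> carrier C" "h2 f \<in> carrier C" "h2 g \<in> carrier C"
          using cd fg PA by (auto simp: J_def)
        \<comment> \<open>This is f + g - f g, so that 1 - k = (1 - f)(1 - g) kills both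
          \<open>c\<close> and \<open>d\<close>.\<close>
        define k where "k = f \<oplus>\<^bsub>A\<^esub> (g \<oplus>\<^bsub>A\<^esub> (\<ominus>\<^bsub>A\<^esub> f) \<otimes>\<^bsub>A\<^esub> g)"
        have "k \<in> P" unfolding k_def using fg PA by (intro Padd Pmult) auto
        have hk: "h2 k = h2 f \<oplus>\<^bsub>C\<^esub> (h2 g \<oplus>\<^bsub>C\<^esub> (\<ominus>\<^bsub>C\<^esub> h2 f) \<otimes>\<^bsub>C\<^esub> h2 g)"
          unfolding k_def using PA fg by simp
        have "h2 k \<otimes>\<^bsub>C\<^esub> (c \<oplus>\<^bsub>C\<^esub> d) =
          h2 f \<otimes>\<^bsub>C\<^esub> c \<oplus>\<^bsub>C\<^esub> h2 g \<otimes>\<^bsub>C\<^esub> (c \<ominus>\<^bsub>C\<^esub> h2 f \<otimes>\<^bsub>C\<^esub> c)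
          \<oplus>\<^bsub>C\<^esub> h2 f \<otimes>\<^bsub>C\<^esub> (d \<ominus>\<^bsub>C\<^esub> h2 g \<otimes>\<^bsub>C\<^esub> d) \<oplus>\<^bsub>C\<^esub> h2 g \<otimes>\<^bsub>C\<^esub> d"
          unfolding hk using c by algebra
        also have "\<dots> = c \<oplus>\<^bsub>C\<^esub> d"
          unfolding fg(3)[symmetric] fg(4)[symmetric] using c by algebra
        finally show ?thesis using \<open>k \<in> P\<close> c unfolding J_def by force
      qed
    qed
    fix c x assume c: "c \<in> J" and x: "x \<in> carrier C"
    then obtain f where f: "f \<in> P" "c = h2 f \<otimes>\<^bsub>C\<^esub> c" "c \<in> carrier C" "h2 f \<in> carrier C"
      unfolding J_def using PA by auto
    have "h2 f \<otimes>\<^bsub>C\<^esub> (x \<otimes>\<^bsub>C\<^esub> c) = x \<otimes>\<^bsub>C\<^esub> (h2 f \<otimes>\<^bsub>C\<^esub> c)" using f(3,4) x by algebra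
    then show xc: "x \<otimes>\<^bsub>C\<^esub> c \<in> J" 
      unfolding J_def using f x by (auto intro!: bexI[of _ f])
    then show "c \<otimes>\<^bsub>C\<^esub> x \<in> J" using f x C.m_comm by simp
  qed
  interpret J: ideal J C by (rule Jid)
  interpret q: ring_hom_cring C "C Quot J" "(+>\<^bsub>C\<^esub>) J" by (rule J.rcos_ring_hom_cring[OF C.is_cring])
  have "\<one>\<^bsub>C\<^esub> \<notin> J"
  proof
    assume "\<one>\<^bsub>C\<^esub> \<in> J"
    then obtain f where "f \<in> P" "\<one>\<^bsub>C\<^esub> = h2 f" unfolding J_def using PA by auto
    then have "f = \<one>\<^bsub>A\<^esub>" using PA inj by (auto simp: inj_on_def)
    with P1 \<open>f \<in> P\<close> show False by simp
  qed
  then have one: "J +>\<^bsub>C\<^esub> \<one>\<^bsub>C\<^esub> \<noteq> \<zero>\<^bsub>C Quot J\<^esub>"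
    using C.quotient_eq_iff_same_a_r_cos[OF Jid, of "\<one>\<^bsub>C\<^esub>" "\<zero>\<^bsub>C\<^esub>"] q.hom_zero
    by (metis C.minus_eq C.minus_zero C.one_closed C.r_zero C.zero_closed)
  have decomp: "\<exists>a\<in>carrier A. x \<ominus>\<^bsub>B\<^esub> h1 a \<otimes>\<^bsub>B\<^esub> e \<in> H" if x: "x \<in> carrier B" for x
  proof (cases "x \<in> H")
    case True
    then show ?thesis using x e by (intro bexI[of _ "\<zero>\<^bsub>A\<^esub>"]) (auto simp: B.minus_eq)
  next
    case False
    then obtain k a where ka: "k \<in> H" "a \<in> carrier A" "e = k \<oplus>\<^bsub>B\<^esub> h1 a \<otimes>\<^bsub>B\<^esub> x"
      using ext[OF x] by blast
    obtain a' where a': "a' \<in> carrier A" "a \<otimes>\<^bsub>A\<^esub> a' \<otimes>\<^bsub>A\<^esub> a = a" using reg[OF ka(2)] by blast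
    \<comment> \<open>\<open>g\<close> is the idempotent complementary to \<open>a' a\<close>, and
      it kills \<open>a\<close>. On the \<open>a' a\<close> part, e = k + a x can be solved for
      \<open>x\<close> by multiplying with \<open>a'\<close>. On the \<open>g\<close> part, both
      \<open>e\<close> and \<open>x\<close> turn out to lie in \<open>H\<close>, so the coefficient
      of \<open>x\<close> is \<open>a'\<close>.\<close>
    define g where "g = \<one>\<^bsub>A\<^esub> \<ominus>\<^bsub>A\<^esub> a' \<otimes>\<^bsub>A\<^esub> a"
    have g: "g \<in> carrier A" using a' ka by (simp add: g_def)
    have c: "k \<in> carrier B" "h1 a \<in> carrier B" "h1 a' \<in> carrier B" "h1 g \<in> carrier B"
      using ka a' g HD(1) by auto
    have haa: "h1 a \<otimes>\<^bsub>B\<^esub> h1 a' \<otimes>\<^bsub>B\<^esub> h1 a = h1 a" using a' ka by (simp flip: h1.hom_mult)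
    have hg: "h1 g = \<one>\<^bsub>B\<^esub> \<ominus>\<^bsub>B\<^esub> h1 a' \<otimes>\<^bsub>B\<^esub> h1 a" using a' ka by (simp add: g_def A.minus_eq B.minus_eq)
    have ga: "h1 g \<otimes>\<^bsub>B\<^esub> h1 a = \<zero>\<^bsub>B\<^esub>"
    proof -
      have "h1 g \<otimes>\<^bsub>B\<^esub> h1 a = h1 a \<ominus>\<^bsub>B\<^esub> h1 a \<otimes>\<^bsub>B\<^esub> h1 a' \<otimes>\<^bsub>B\<^esub> h1 a"
        unfolding hg using c by algebra
      then show ?thesis unfolding haa using c by simp
    qed
    have ge: "h1 g \<otimes>\<^bsub>B\<^esub> e \<in> H"
    proof -
      have "h1 g \<otimes>\<^bsub>B\<^esub> e = h1 g \<otimes>\<^bsub>B\<^esub> k \<oplus>\<^bsub>B\<^esub> (h1 g \<otimes>\<^bsub>B\<^esub> h1 a) \<otimes>\<^bsub>B\<^esub> x"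
        unfolding ka(3) using c x by algebra
      then show ?thesis unfolding ga using c x HD(4)[OF g ka(1)] by simp
    qed
    have gx: "h1 g \<otimes>\<^bsub>B\<^esub> x \<in> H"
    proof (rule ccontr)
      assume "h1 g \<otimes>\<^bsub>B\<^esub> x \<notin> H"
      then obtain l b where lb: "l \<in> H" "b \<in> carrier A" "e = l \<oplus>\<^bsub>B\<^esub> h1 b \<otimes>\<^bsub>B\<^esub> (h1 g \<otimes>\<^bsub>B\<^esub> x)"
        using ext[of "h1 g \<otimes>\<^bsub>B\<^esub> x"] c x by auto
      have d: "l \<in> carrier B" "h1 b \<in> carrier B" using lb HD(1) by auto
      \<comment> \<open>Were \<open>g x\<close> outside \<open>H\<close>, extension would give e = l
        + b g x. Then \<open>a e\<close> is in \<open>H\<close> because \<open>g\<close> kills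
        \<open>a\<close>, and e = a' a e + g e would be in \<open>H\<close> too.\<close>
      have "h1 a \<otimes>\<^bsub>B\<^esub> e = h1 a \<otimes>\<^bsub>B\<^esub> l \<oplus>\<^bsub>B\<^esub> h1 b \<otimes>\<^bsub>B\<^esub> ((h1 g \<otimes>\<^bsub>B\<^esub> h1 a) \<otimes>\<^bsub>B\<^esub> x)"
        by (subst lb(3)) (use c d x in algebra)
      then have "h1 a \<otimes>\<^bsub>B\<^esub> e \<in> H" unfolding ga using c d x HD(4)[OF ka(2) lb(1)] by simp
      then have "h1 a' \<otimes>\<^bsub>B\<^esub> (h1 a \<otimes>\<^bsub>B\<^esub> e) \<in> H" using HD(4) a' by blast
      then have "h1 a' \<otimes>\<^bsub>B\<^esub> (h1 a \<otimes>\<^bsub>B\<^esub> e) \<oplus>\<^bsub>B\<^esub> h1 g \<otimes>\<^bsub>B\<^esub> e \<in> H" using ge HD(3) by blast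
      moreover have "h1 a' \<otimes>\<^bsub>B\<^esub> (h1 a \<otimes>\<^bsub>B\<^esub> e) \<oplus>\<^bsub>B\<^esub> h1 g \<otimes>\<^bsub>B\<^esub> e = e"
        unfolding hg using c e(1) by algebra
      ultimately show False using eH by simp
    qed
    have "x \<ominus>\<^bsub>B\<^esub> h1 a' \<otimes>\<^bsub>B\<^esub> e = h1 g \<otimes>\<^bsub>B\<^esub> x \<ominus>\<^bsub>B\<^esub> h1 a' \<otimes>\<^bsub>B\<^esub> k"
      unfolding hg by (subst ka(3)) (use c x in algebra)
    then have "x \<ominus>\<^bsub>B\<^esub> h1 a' \<otimes>\<^bsub>B\<^esub> e \<in> H" using gx HD(4)[OF a'(1) ka(1)] diffH by simp
    then show ?thesis using a' by blast
  qed
  \<comment> \<open>The map B -> B/H = A/P -> C/J. The choice of coefficient is immaterial modulo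
    \<open>J\<close>, as \<open>feq\<close> shows, so additivity and linearity follow by exhibiting
    suitable coefficients.\<close>
  define f where "f x = J +>\<^bsub>C\<^esub> h2 (SOME a. a \<in> carrier A \<and> x \<ominus>\<^bsub>B\<^esub> h1 a \<otimes>\<^bsub>B\<^esub> e \<in> H)" for x
  have feq: "f x = J +>\<^bsub>C\<^esub> h2 a"
    if x: "x \<in> carrier B" and a: "a \<in> carrier A" "x \<ominus>\<^bsub>B\<^esub> h1 a \<otimes>\<^bsub>B\<^esub> e \<in> H" for x a
  proof -
    define b where "b = (SOME a. a \<in> carrier A \<and> x \<ominus>\<^bsub>B\<^esub> h1 a \<otimes>\<^bsub>B\<^esub> e \<in> H)"
    have b: "b \<in> carrier A" "x \<ominus>\<^bsub>B\<^esub> h1 b \<otimes>\<^bsub>B\<^esub> e \<in> H"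
      using someI[of "\<lambda>a. a \<in> carrier A \<and> x \<ominus>\<^bsub>B\<^esub> h1 a \<otimes>\<^bsub>B\<^esub> e \<in> H" a] a by (auto simp: b_def)
    have c: "h1 a \<in> carrier B" "h1 b \<in> carrier B" using a b by auto
    have "h1 (b \<ominus>\<^bsub>A\<^esub> a) \<otimes>\<^bsub>B\<^esub> e = (h1 b \<ominus>\<^bsub>B\<^esub> h1 a) \<otimes>\<^bsub>B\<^esub> e"
      using a b by (simp add: A.minus_eq B.minus_eq)
    also have "\<dots> = (x \<ominus>\<^bsub>B\<^esub> h1 a \<otimes>\<^bsub>B\<^esub> e) \<ominus>\<^bsub>B\<^esub> (x \<ominus>\<^bsub>B\<^esub> h1 b \<otimes>\<^bsub>B\<^esub> e)"
      using c x e(1) by algebra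
    finally have "b \<ominus>\<^bsub>A\<^esub> a \<in> P" using diffH[OF a(2) b(2)] a b by (simp add: P_def)
    from JP[OF this] have "h2 b \<ominus>\<^bsub>C\<^esub> h2 a \<in> J" using a b by (simp add: A.minus_eq C.minus_eq)
    then show ?thesis
      using C.quotient_eq_iff_same_a_r_cos[OF Jid] a b by (simp add: f_def b_def[symmetric])
  qed
  show ?thesis
  proof (rule that[OF Jid, of f])
    show "f \<in> carrier B \<rightarrow> carrier (C Quot J)"
    proof
      fix x assume "x \<in> carrier B"
      then show "f x \<in> carrier (C Quot J)" using decomp[of x] feq[of x] by (metis h2.hom_closed q.hom_closed)
    qed
  next
    fix x y assume x: "x \<in> carrier B" and y: "y \<in> carrier B"
    obtain a b where a: "a \<in> carrier A" "x \<ominus>\<^bsub>B\<^esub> h1 a \<otimes>\<^bsub>B\<^esub> e \<in> H"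
      and b: "b \<in> carrier A" "y \<ominus>\<^bsub>B\<^esub> h1 b \<otimes>\<^bsub>B\<^esub> e \<in> H" using decomp x y by blast
    have c: "h1 a \<in> carrier B" "h1 b \<in> carrier B" using a b by auto
    have "(x \<oplus>\<^bsub>B\<^esub> y) \<ominus>\<^bsub>B\<^esub> h1 (a \<oplus>\<^bsub>A\<^esub> b) \<otimes>\<^bsub>B\<^esub> e
      = (x \<ominus>\<^bsub>B\<^esub> h1 a \<otimes>\<^bsub>B\<^esub> e) \<oplus>\<^bsub>B\<^esub> (y \<ominus>\<^bsub>B\<^esub> h1 b \<otimes>\<^bsub>B\<^esub> e)"
      unfolding h1.hom_add[OF a(1) b(1)] using c x y e(1) by algebra
    then have "f (x \<oplus>\<^bsub>B\<^esub> y) = J +>\<^bsub>C\<^esub> h2 (a \<oplus>\<^bsub>A\<^esub> b)"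
      using HD(3)[OF a(2) b(2)] a b x y by (intro feq) auto
    then show "f (x \<oplus>\<^bsub>B\<^esub> y) = f x \<oplus>\<^bsub>C Quot J\<^esub> f y"
      using feq[OF x a] feq[OF y b] a b by simp
  next
    fix a x assume a: "a \<in> carrier A" and x: "x \<in> carrier B"
    obtain b where b: "b \<in> carrier A" "x \<ominus>\<^bsub>B\<^esub> h1 b \<otimes>\<^bsub>B\<^esub> e \<in> H" using decomp x by blast
    have c: "h1 a \<in> carrier B" "h1 b \<in> carrier B" using a b by auto
    have "h1 a \<otimes>\<^bsub>B\<^esub> x \<ominus>\<^bsub>B\<^esub> h1 (a \<otimes>\<^bsub>A\<^esub> b) \<otimes>\<^bsub>B\<^esub> e = h1 a \<otimes>\<^bsub>B\<^esub> (x \<ominus>\<^bsub>B\<^esub> h1 b \<otimes>\<^bsub>B\<^esub> e)"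
      unfolding h1.hom_mult[OF a b(1)] using c x e(1) by algebra
    then have "f (h1 a \<otimes>\<^bsub>B\<^esub> x) = J +>\<^bsub>C\<^esub> h2 (a \<otimes>\<^bsub>A\<^esub> b)"
      using HD(4)[OF a b(2)] a b x by (intro feq) auto
    then show "f (h1 a \<otimes>\<^bsub>B\<^esub> x) = (J +>\<^bsub>C\<^esub> h2 a) \<otimes>\<^bsub>C Quot J\<^esub> f x"
      using feq[OF x b] a b by simp
  next
    have "f e = J +>\<^bsub>C\<^esub> h2 \<one>\<^bsub>A\<^esub>"
      using e HD(2) by (intro feq) (auto simp: B.minus_eq B.r_neg)
    then show "f e \<noteq> \<zero>\<^bsub>C Quot J\<^esub>" using one by simp
  qed
qed

text \<open>The field is the residue field of the generated commutative ring at a maximal ideal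
  containing 1 - e. The last conclusion is kept because p-th roots will be extended from generators
  to the whole field.\<close>

lemma (in ring) exists_field_of_commuting_idempotent:
  assumes G: "G \<subseteq> carrier R" and comm: "\<And>x y. x \<in> G \<Longrightarrow> y \<in> G \<Longrightarrow> x \<otimes> y = y \<otimes> x"
    and e: "e \<in> G" "e \<otimes> e = e" "e \<noteq> \<zero>"
  obtains F :: "'a set ring" and q where "field F"
    "q \<in> ring_hom (R \<lparr> carrier := generate_ring R G \<rparr>) F"
    "q e = \<one>\<^bsub>F\<^esub>" "carrier F = generate_ring F (q ` G)"
proof -
  define S where "S = R \<lparr> carrier := generate_ring R G \<rparr>"
  have S_simps: "carrier S = generate_ring R G" "\<zero>\<^bsub>S\<^esub> = \<zero>" "\<one>\<^bsub>S\<^esub> = \<one>"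
    "x \<oplus>\<^bsub>S\<^esub> y = x \<oplus> y" "x \<otimes>\<^bsub>S\<^esub> y = x \<otimes> y" for x y
    by (simp_all add: S_def)
  interpret S: cring S unfolding S_def by (rule generate_ring_cring[OF G comm])
  have GS: "G \<subseteq> carrier S" using generate_ring.incl by (auto simp: S_simps)
  \<comment> \<open>\<open>a_inv\<close> depends on the carrier. \<open>generate_ring\<close> closes
    under negation in \<open>R\<close>, whereas the quotient map respects negation in
    \<open>S\<close>; the two agree.\<close>
  have inv_S: "\<ominus>\<^bsub>S\<^esub> x = \<ominus> x" if "x \<in> carrier S" for x
  proof -
    have "x \<in> carrier R" using that generate_ring_incl[OF G] by (auto simp: S_simps)
    then show ?thesis
      using that generate_ring.a_inv[of x R G]
      by (intro S.minus_equality) (auto simp: S_simps l_neg)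
  qed
  have eS: "e \<in> carrier S" using e GS by blast
  have eS2: "e \<otimes>\<^bsub>S\<^esub> e = e" "e \<noteq> \<zero>\<^bsub>S\<^esub>" using e by (simp_all add: S_simps)
  define I where "I = PIdl\<^bsub>S\<^esub> (\<one>\<^bsub>S\<^esub> \<ominus>\<^bsub>S\<^esub> e)"
  have I: "ideal I S" unfolding I_def using eS by (intro S.cgenideal_ideal) auto
  have "\<one>\<^bsub>S\<^esub> \<notin> I"
  proof
    assume "\<one>\<^bsub>S\<^esub> \<in> I"
    then obtain r where r: "r \<in> carrier S" "\<one>\<^bsub>S\<^esub> = r \<otimes>\<^bsub>S\<^esub> (\<one>\<^bsub>S\<^esub> \<ominus>\<^bsub>S\<^esub> e)"
      unfolding I_def cgenideal_def by blast
    \<comment> \<open>If 1 = r (1 - e), multiplying by \<open>e\<close> gives e = r (e - e e) =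
      0.\<close>
    have "e = e \<otimes>\<^bsub>S\<^esub> (r \<otimes>\<^bsub>S\<^esub> (\<one>\<^bsub>S\<^esub> \<ominus>\<^bsub>S\<^esub> e))"
      using eS by (simp flip: r(2))
    also have "\<dots> = r \<otimes>\<^bsub>S\<^esub> (e \<ominus>\<^bsub>S\<^esub> e \<otimes>\<^bsub>S\<^esub> e)" using r(1) eS by algebra
    also have "\<dots> = \<zero>\<^bsub>S\<^esub>" unfolding eS2(1) using r(1) eS by algebra
    finally show False using eS2 by simp
  qed
  then obtain M where M: "maximalideal M S" "I \<subseteq> M" using S.exists_maximalideal[OF I] by blast
  interpret M: maximalideal M S by (rule M(1))
  interpret F: field "S Quot M" by (rule M.quotient_is_field[OF S.is_cring])
  interpret q: ring_hom_cring S "S Quot M" "(+>\<^bsub>S\<^esub>) M"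
    by (rule M.rcos_ring_hom_cring[OF S.is_cring])
  have "\<one>\<^bsub>S\<^esub> \<ominus>\<^bsub>S\<^esub> e \<in> M"
    using M(2) S.cgenideal_self[of "\<one>\<^bsub>S\<^esub> \<ominus>\<^bsub>S\<^esub> e"] eS unfolding I_def by auto
  then have qe: "M +>\<^bsub>S\<^esub> e = \<one>\<^bsub>S Quot M\<^esub>"
    using S.quotient_eq_iff_same_a_r_cos[OF M.is_ideal, of "\<one>\<^bsub>S\<^esub>" e] eS by (simp flip: q.hom_one)
  have "M +>\<^bsub>S\<^esub> x \<in> generate_ring (S Quot M) ((+>\<^bsub>S\<^esub>) M ` G)" if "x \<in> generate_ring R G" for x
    using that
  proof induction
    case one
    show ?case using q.hom_one generate_ring.one[of "S Quot M"] by (simp add: S_simps)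
  next
    case (incl x)
    then show ?case by (intro generate_ring.incl) blast
  next
    case (a_inv x)
    then have "M +>\<^bsub>S\<^esub> (\<ominus> x) = \<ominus>\<^bsub>S Quot M\<^esub> (M +>\<^bsub>S\<^esub> x)"
      using inv_S[of x] q.hom_a_inv[of x] by (simp add: S_simps)
    then show ?case using a_inv by (simp add: generate_ring.a_inv)
  next
    case (eng_add x y)
    then have "M +>\<^bsub>S\<^esub> (x \<oplus> y) = (M +>\<^bsub>S\<^esub> x) \<oplus>\<^bsub>S Quot M\<^esub> (M +>\<^bsub>S\<^esub> y)"
      using q.hom_add[of x y] by (simp add: S_simps)
    then show ?case using eng_add by (simp add: generate_ring.eng_add)
  next
    case (eng_mult x y)
    then have "M +>\<^bsub>S\<^esub> (x \<otimes> y) = (M +>\<^bsub>S\<^esub> x) \<otimes>\<^bsub>S Quot M\<^esub> (M +>\<^bsub>S\<^esub> y)"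
      using q.hom_mult[of x y] by (simp add: S_simps)
    then show ?case using eng_mult by (simp add: generate_ring.eng_mult)
  qed
  then have "carrier (S Quot M) \<subseteq> generate_ring (S Quot M) ((+>\<^bsub>S\<^esub>) M ` G)"
    by (auto simp: FactRing_def A_RCOSETS_def' S_simps)
  moreover have "generate_ring (S Quot M) ((+>\<^bsub>S\<^esub>) M ` G) \<subseteq> carrier (S Quot M)"
    using GS by (intro F.generate_ring_incl) auto
  ultimately show ?thesis
    using that[of "S Quot M" "(+>\<^bsub>S\<^esub>) M"] F.field_axioms q.homh qe by (simp add: S_def)
qed

text \<open>Hom_A(B, U), with \<open>A\<close> acting on \<open>B\<close> through \<open>h\<close>
  and on \<open>U\<close> through \<open>u\<close>. The \<open>ring\<close> record serves as a
  vehicle for an additive group, hence the \<open>undefined\<close> multiplication and unit.\<close>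

definition hom_group ::
  "('a, 'm) ring_scheme \<Rightarrow> ('b, 'n) ring_scheme \<Rightarrow> ('u, 'k) ring_scheme \<Rightarrow> ('a \<Rightarrow> 'b) \<Rightarrow> ('a \<Rightarrow> 'u) \<Rightarrow>
    ('b \<Rightarrow> 'u) ring" where
  "hom_group A B U h u = \<lparr> carrier = {f \<in> carrier B \<rightarrow>\<^sub>E carrier U.
       (\<forall>x\<in>carrier B. \<forall>y\<in>carrier B. f (x \<oplus>\<^bsub>B\<^esub> y) = f x \<oplus>\<^bsub>U\<^esub> f y) \<and>
       (\<forall>a\<in>carrier A. \<forall>x\<in>carrier B. f (h a \<otimes>\<^bsub>B\<^esub> x) = u a \<otimes>\<^bsub>U\<^esub> f x)},
     monoid.mult = (\<lambda>f g. undefined), one = undefined,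
     zero = (\<lambda>x\<in>carrier B. \<zero>\<^bsub>U\<^esub>), add = (\<lambda>f g. \<lambda>x\<in>carrier B. f x \<oplus>\<^bsub>U\<^esub> g x) \<rparr>"

lemma hom_group_memI:
  assumes "f \<in> carrier B \<rightarrow>\<^sub>E carrier U"
    "\<And>x y. x \<in> carrier B \<Longrightarrow> y \<in> carrier B \<Longrightarrow> f (x \<oplus>\<^bsub>B\<^esub> y) = f x \<oplus>\<^bsub>U\<^esub> f y"
    "\<And>a x. a \<in> carrier A \<Longrightarrow> x \<in> carrier B \<Longrightarrow> f (h a \<otimes>\<^bsub>B\<^esub> x) = u a \<otimes>\<^bsub>U\<^esub> f x"
  shows "f \<in> carrier (hom_group A B U h u)"
  using assms by (simp add: hom_group_def)

lemma hom_group_memD: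
  assumes "f \<in> carrier (hom_group A B U h u)"
  shows "f \<in> extensional (carrier B)" "x \<in> carrier B \<Longrightarrow> f x \<in> carrier U"
    "x \<in> carrier B \<Longrightarrow> y \<in> carrier B \<Longrightarrow> f (x \<oplus>\<^bsub>B\<^esub> y) = f x \<oplus>\<^bsub>U\<^esub> f y"
    "a \<in> carrier A \<Longrightarrow> x \<in> carrier B \<Longrightarrow> f (h a \<otimes>\<^bsub>B\<^esub> x) = u a \<otimes>\<^bsub>U\<^esub> f x"
  using assms by (auto simp: hom_group_def PiE_def)

lemma hom_group_apply:
  "x \<in> carrier B \<Longrightarrow> (f \<oplus>\<^bsub>hom_group A B U h u\<^esub> g) x = f x \<oplus>\<^bsub>U\<^esub> g x"
  "x \<in> carrier B \<Longrightarrow> \<zero>\<^bsub>hom_group A B U h u\<^esub> x = \<zero>\<^bsub>U\<^esub>"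
  by (simp_all add: hom_group_def)

lemma hom_group_ext:
  assumes "f \<in> carrier (hom_group A B U h u)" "g \<in> carrier (hom_group A B U h u)"
    "\<And>x. x \<in> carrier B \<Longrightarrow> f x = g x"
  shows "f = g"
  using hom_group_memD(1)[OF assms(1)] hom_group_memD(1)[OF assms(2)] assms(3)
  by (rule extensionalityI)

lemma abelian_group_hom_group:
  assumes "ring B" "ring U" and "h \<in> carrier A \<rightarrow> carrier B" "u \<in> carrier A \<rightarrow> carrier U"
  shows "abelian_group (hom_group A B U h u)" (is "abelian_group ?V")
proof -
  interpret B: ring B by fact
  interpret U: ring U by fact
  have hu: "h a \<in> carrier B" "u a \<in> carrier U" if "a \<in> carrier A" for a using assms that by auto
  have add: "f \<oplus>\<^bsub>?V\<^esub> g \<in> carrier ?V" if f: "f \<in> carrier ?V" and g: "g \<in> carrier ?V" for f g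
  proof (rule hom_group_memI)
    show "f \<oplus>\<^bsub>?V\<^esub> g \<in> carrier B \<rightarrow>\<^sub>E carrier U"
      using hom_group_memD(2)[OF f] hom_group_memD(2)[OF g] by (auto simp: hom_group_def)
  qed (simp_all add: hom_group_apply hu hom_group_memD[OF f] hom_group_memD[OF g] U.a_ac U.r_distr)
  have zero: "\<zero>\<^bsub>?V\<^esub> \<in> carrier ?V"
    by (rule hom_group_memI) (auto simp: hom_group_def hu)
  have neg: "(\<lambda>x\<in>carrier B. \<ominus>\<^bsub>U\<^esub> f x) \<in> carrier ?V" if f: "f \<in> carrier ?V" for f
    by (rule hom_group_memI) (auto simp: hu hom_group_memD[OF f] U.minus_add U.r_minus)
  show ?thesis
  proof (rule abelian_groupI)
    fix f assume f: "f \<in> carrier ?V"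
    have "(\<lambda>x\<in>carrier B. \<ominus>\<^bsub>U\<^esub> f x) \<oplus>\<^bsub>?V\<^esub> f = \<zero>\<^bsub>?V\<^esub>"
      using f hom_group_memD(2)[OF f]
      by (intro hom_group_ext[OF add[OF neg] zero]) (auto simp: hom_group_apply U.l_neg)
    then show "\<exists>g\<in>carrier ?V. g \<oplus>\<^bsub>?V\<^esub> f = \<zero>\<^bsub>?V\<^esub>" using neg[OF f] by blast
  qed (auto intro!: hom_group_ext add zero simp: hom_group_apply hom_group_memD(2) U.a_ac)
qed

text \<open>\<open>B\<close> and \<open>C\<close> act by commuting operators on the \<open>A\<close>-linear maps from \<open>B\<close> to a quotient of \<open>C\<close>, and
  the two actions agree on \<open>A\<close>; the generated ring of operators replaces the tensor product.\<close>
lemma exists_amalgamating_field: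
  assumes "cring A" "cring B" "cring C"
    and reg: "\<And>a. a \<in> carrier A \<Longrightarrow> \<exists>a'\<in>carrier A. a \<otimes>\<^bsub>A\<^esub> a' \<otimes>\<^bsub>A\<^esub> a = a"
    and "h1 \<in> ring_hom A B" "h2 \<in> ring_hom A C" and inj: "inj_on h2 (carrier A)"
    and e: "e \<in> carrier B" "e \<noteq> \<zero>\<^bsub>B\<^esub>" "e \<otimes>\<^bsub>B\<^esub> e = e"
  obtains F :: "(('b \<Rightarrow> 'c set) \<Rightarrow> 'b \<Rightarrow> 'c set) set ring" and g1 :: "'b \<Rightarrow> _" and g2 :: "'c \<Rightarrow> _"
  where "field F" "g1 \<in> ring_hom B F" "g2 \<in> ring_hom C F"
    "\<And>a. a \<in> carrier A \<Longrightarrow> g1 (h1 a) = g2 (h2 a)" "g1 e = \<one>\<^bsub>F\<^esub>"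
    "carrier F = generate_ring F (g1 ` carrier B \<union> g2 ` carrier C)"
proof -
  interpret A: cring A by fact
  interpret B: cring B by fact
  interpret C: cring C by fact
  interpret h1: ring_hom_cring A B h1
    using assms by (intro ring_hom_cringI ring_hom_ringI2 A.ring_axioms B.ring_axioms)
  interpret h2: ring_hom_cring A C h2
    using assms by (intro ring_hom_cringI ring_hom_ringI2 A.ring_axioms C.ring_axioms)
  obtain J f where J: "ideal J C" and f: "f \<in> carrier B \<rightarrow> carrier (C Quot J)"
    "\<And>x y. x \<in> carrier B \<Longrightarrow> y \<in> carrier B \<Longrightarrow> f (x \<oplus>\<^bsub>B\<^esub> y) = f x \<oplus>\<^bsub>C Quot J\<^esub> f y"
    "\<And>a x. a \<in> carrier A \<Longrightarrow> x \<in> carrier B \<Longrightarrow>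
       f (h1 a \<otimes>\<^bsub>B\<^esub> x) = (J +>\<^bsub>C\<^esub> h2 a) \<otimes>\<^bsub>C Quot J\<^esub> f x"
    "f e \<noteq> \<zero>\<^bsub>C Quot J\<^esub>"
    using assms(1-7) e(1,2) by (rule exists_functional) (blast, rule that)
  interpret J: ideal J C by (rule J)
  interpret q: ring_hom_cring C "C Quot J" "(+>\<^bsub>C\<^esub>) J" by (rule J.rcos_ring_hom_cring[OF C.is_cring])
  define V where "V = hom_group A B (C Quot J) h1 (\<lambda>a. J +>\<^bsub>C\<^esub> h2 a)"
  have V: "abelian_group V"
    unfolding V_def using B.ring_axioms q.S.ring_axioms by (rule abelian_group_hom_group) auto
  interpret V: abelian_group V by (rule V)
  interpret E: ring "End_ring V" by (rule ring_End_ring[OF V])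
  note VI = hom_group_memI[of _ B "C Quot J" A h1 "\<lambda>a. J +>\<^bsub>C\<^esub> h2 a", folded V_def]
  note VD = hom_group_memD[of _ A B "C Quot J" h1 "\<lambda>a. J +>\<^bsub>C\<^esub> h2 a", folded V_def]
  note Vext = hom_group_ext[of _ A B "C Quot J" h1 "\<lambda>a. J +>\<^bsub>C\<^esub> h2 a", folded V_def]
  note Vap = hom_group_apply[where A=A and B=B and U="C Quot J" and h=h1
      and u="\<lambda>a. J +>\<^bsub>C\<^esub> h2 a", folded V_def]
  \<comment> \<open>\<open>l b\<close> changes the argument and \<open>m c\<close> changes the
    value, which is why they commute. On \<open>A\<close> they coincide because members of
    \<open>V\<close> are \<open>A\<close>-linear.\<close>
  define l where "l b = (\<lambda>f\<in>carrier V. \<lambda>x\<in>carrier B. f (b \<otimes>\<^bsub>B\<^esub> x))" for b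
  define m where "m c = (\<lambda>f\<in>carrier V. \<lambda>x\<in>carrier B. (J +>\<^bsub>C\<^esub> c) \<otimes>\<^bsub>C Quot J\<^esub> f x)" for c
  have lap: "l b g x = g (b \<otimes>\<^bsub>B\<^esub> x)" if "g \<in> carrier V" "x \<in> carrier B" for b g x
    using that by (simp add: l_def)
  have map: "m c g x = (J +>\<^bsub>C\<^esub> c) \<otimes>\<^bsub>C Quot J\<^esub> g x" if "g \<in> carrier V" "x \<in> carrier B" for c g x
    using that by (simp add: m_def)
  have lV: "l b g \<in> carrier V" if b: "b \<in> carrier B" and g: "g \<in> carrier V" for b g
  proof (rule VI)
    show "l b g \<in> carrier B \<rightarrow>\<^sub>E carrier (C Quot J)" using b g VD(2)[OF g] by (auto simp: l_def)
    show "l b g (x \<oplus>\<^bsub>B\<^esub> y) = l b g x \<oplus>\<^bsub>C Quot J\<^esub> l b g y" if "x \<in> carrier B" "y \<in> carrier B" for x y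
      using that b VD(3)[OF g] by (simp add: lap[OF g] B.r_distr)
    show "l b g (h1 a \<otimes>\<^bsub>B\<^esub> x) = (J +>\<^bsub>C\<^esub> h2 a) \<otimes>\<^bsub>C Quot J\<^esub> l b g x"
      if "a \<in> carrier A" "x \<in> carrier B" for a x
      using that b VD(4)[OF g that(1), of "b \<otimes>\<^bsub>B\<^esub> x"] by (simp add: lap[OF g] B.m_lcomm)
  qed
  have mV: "m c g \<in> carrier V" if c: "c \<in> carrier C" and g: "g \<in> carrier V" for c g
  proof (rule VI)
    show "m c g \<in> carrier B \<rightarrow>\<^sub>E carrier (C Quot J)" using c g VD(2)[OF g] by (auto simp: m_def)
    show "m c g (x \<oplus>\<^bsub>B\<^esub> y) = m c g x \<oplus>\<^bsub>C Quot J\<^esub> m c g y" if "x \<in> carrier B" "y \<in> carrier B" for x y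
      using that c VD(2,3)[OF g] by (simp add: map[OF g] q.S.r_distr)
    show "m c g (h1 a \<otimes>\<^bsub>B\<^esub> x) = (J +>\<^bsub>C\<^esub> h2 a) \<otimes>\<^bsub>C Quot J\<^esub> m c g x"
      if "a \<in> carrier A" "x \<in> carrier B" for a x
      using that c VD(2,4)[OF g] by (simp add: map[OF g] q.S.m_lcomm)
  qed
  have EI: "T \<in> carrier (End_ring V)" if "T \<in> extensional (carrier V)"
    "\<And>g. g \<in> carrier V \<Longrightarrow> T g \<in> carrier V"
    "\<And>g k x. g \<in> carrier V \<Longrightarrow> k \<in> carrier V \<Longrightarrow> x \<in> carrier B \<Longrightarrow>
       T (g \<oplus>\<^bsub>V\<^esub> k) x = T g x \<oplus>\<^bsub>C Quot J\<^esub> T k x" for T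
    using that by (auto simp: End_ring_def PiE_def Vap intro!: Vext)
  have lE: "l b \<in> carrier (End_ring V)" if "b \<in> carrier B" for b
  proof (rule EI)
    show "l b \<in> extensional (carrier V)" by (simp add: l_def)
  qed (use that in \<open>simp_all add: lV lap Vap\<close>)
  have mE: "m c \<in> carrier (End_ring V)" if "c \<in> carrier C" for c
  proof (rule EI)
    show "m c \<in> extensional (carrier V)" by (simp add: m_def)
  qed (use that in \<open>simp_all add: mV map Vap VD(2) q.S.r_distr\<close>)
  have Eext: "S = T" if "S \<in> carrier (End_ring V)" "T \<in> carrier (End_ring V)"
    "\<And>g x. g \<in> carrier V \<Longrightarrow> x \<in> carrier B \<Longrightarrow> S g x = T g x" for S T
  proof (rule extensionalityI[of _ "carrier V"])
    show "S \<in> extensional (carrier V)" "T \<in> extensional (carrier V)"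
      using that(1,2) by (auto simp: End_ring_def PiE_def)
    show "S g = T g" if "g \<in> carrier V" for g
      using \<open>S \<in> carrier (End_ring V)\<close> \<open>T \<in> carrier (End_ring V)\<close> that
      by (intro Vext) (auto simp: End_ring_def intro!: \<open>\<And>g x. g \<in> carrier V \<Longrightarrow> x \<in> carrier B \<Longrightarrow> S g x = T g x\<close>)
  qed
  have Eap: "g \<in> carrier V \<Longrightarrow> (S \<oplus>\<^bsub>End_ring V\<^esub> T) g = S g \<oplus>\<^bsub>V\<^esub> T g"
    "g \<in> carrier V \<Longrightarrow> (S \<otimes>\<^bsub>End_ring V\<^esub> T) g = S (T g)"
    "g \<in> carrier V \<Longrightarrow> \<one>\<^bsub>End_ring V\<^esub> g = g" "g \<in> carrier V \<Longrightarrow> \<zero>\<^bsub>End_ring V\<^esub> g = \<zero>\<^bsub>V\<^esub>"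
    for S T g by (auto simp: End_ring_def)
  have lhom: "l \<in> ring_hom B (End_ring V)"
    by (rule ring_hom_memI)
      (auto intro!: Eext lE simp: Eap lap Vap lV VD(3) B.l_distr B.m_assoc B.m_lcomm)
  have mhom: "m \<in> ring_hom C (End_ring V)"
    by (rule ring_hom_memI)
      (auto intro!: Eext mE simp: Eap map Vap mV VD(2) q.S.l_distr q.S.m_assoc)
  have lm: "l (h1 a) = m (h2 a)" if a: "a \<in> carrier A" for a
    using a by (intro Eext lE mE) (auto simp: lap map VD(4))
  define G where "G = l ` carrier B \<union> m ` carrier C"
  have GE: "G \<subseteq> carrier (End_ring V)" using lE mE by (auto simp: G_def)
  have ll: "l b \<otimes>\<^bsub>End_ring V\<^esub> l b' = l b' \<otimes>\<^bsub>End_ring V\<^esub> l b"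
    if "b \<in> carrier B" "b' \<in> carrier B" for b b'
    using that ring_hom_mult[OF lhom] by (metis B.m_comm)
  have mm: "m c \<otimes>\<^bsub>End_ring V\<^esub> m c' = m c' \<otimes>\<^bsub>End_ring V\<^esub> m c"
    if "c \<in> carrier C" "c' \<in> carrier C" for c c'
    using that ring_hom_mult[OF mhom] by (metis C.m_comm)
  have lmc: "l b \<otimes>\<^bsub>End_ring V\<^esub> m c = m c \<otimes>\<^bsub>End_ring V\<^esub> l b"
    if "b \<in> carrier B" "c \<in> carrier C" for b c
    using that by (intro Eext E.m_closed lE mE) (simp_all add: Eap lap map lV mV)
  have Gcomm: "S \<otimes>\<^bsub>End_ring V\<^esub> T = T \<otimes>\<^bsub>End_ring V\<^esub> S" if "S \<in> G" "T \<in> G" for S T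
    using that ll mm lmc by (auto simp: G_def)
  have le: "l e \<otimes>\<^bsub>End_ring V\<^esub> l e = l e" using ring_hom_mult[OF lhom e(1) e(1)] e by simp
  have le0: "l e \<noteq> \<zero>\<^bsub>End_ring V\<^esub>"
  proof
    assume *: "l e = \<zero>\<^bsub>End_ring V\<^esub>"
    \<comment> \<open>Here the functional pays off: applying \<open>l e\<close> to it and evaluating
      at 1 returns its value at \<open>e\<close>, which is nonzero.\<close>
    define g where "g = restrict f (carrier B)"
    have g: "g \<in> carrier V" by (rule VI) (use f in \<open>auto simp: g_def\<close>)
    have "l e g \<one>\<^bsub>B\<^esub> = f e" using g e by (simp add: lap g_def)
    moreover have "l e g \<one>\<^bsub>B\<^esub> = \<zero>\<^bsub>C Quot J\<^esub>" unfolding * using g by (simp add: Eap Vap)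
    ultimately show False using f by simp
  qed
  have eG: "l e \<in> G" using e by (auto simp: G_def)
  obtain F :: "(('b \<Rightarrow> 'c set) \<Rightarrow> 'b \<Rightarrow> 'c set) set ring" and q where F: "field F"
    "q \<in> ring_hom (End_ring V \<lparr> carrier := generate_ring (End_ring V) G \<rparr>) F"
    "q (l e) = \<one>\<^bsub>F\<^esub>" "carrier F = generate_ring F (q ` G)"
    using E.exists_field_of_commuting_idempotent[OF GE Gcomm eG le le0] by blast
  have restr: "k \<in> ring_hom X (End_ring V \<lparr> carrier := generate_ring (End_ring V) G \<rparr>)"
    if "k \<in> ring_hom X (End_ring V)" "k ` carrier X \<subseteq> G" for k and X :: "('x, 'y) ring_scheme"
    using that generate_ring.incl[of _ G "End_ring V"] by (auto simp: ring_hom_def)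
  have "q \<circ> l \<in> ring_hom B F" "q \<circ> m \<in> ring_hom C F"
    by (auto intro!: ring_hom_trans[OF restr F(2)] lhom mhom simp: G_def)
  moreover have "carrier F = generate_ring F ((q \<circ> l) ` carrier B \<union> (q \<circ> m) ` carrier C)"
    unfolding F(4) G_def by (simp add: image_Un image_comp)
  ultimately show ?thesis using that[of F "q \<circ> l" "q \<circ> m"] F lm by simp
qed

section \<open>Frobenius\<close>

lemma (in cring) binomial_ring:
  assumes x: "x \<in> carrier R" and y: "y \<in> carrier R"
  shows "(x \<oplus> y) [^] n = (\<Oplus>k\<in>{..n}. [(n choose k)] \<cdot> (x [^] k \<otimes> y [^] (n - k)))"
proof (induction n)
  case 0
  then show ?case using x y by simp
next
  case (Suc n)
  \<comment> \<open>Multiplying the sum of \<open>?f\<close> by \<open>x\<close> gives that of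
    \<open>?g\<close>, by \<open>y\<close> that of \<open>?h\<close>. \<open>?h'\<close> is
    \<open>?h\<close> shifted by one, so that \<open>?g\<close> and \<open>?h'\<close> carry the
    same monomials and Pascal's rule adds their coefficients.\<close>
  let ?f = "\<lambda>k. [(n choose k)] \<cdot> (x [^] k \<otimes> y [^] (n - k))"
  let ?g = "\<lambda>k. [(n choose k)] \<cdot> (x [^] Suc k \<otimes> y [^] (n - k))"
  let ?h = "\<lambda>k. [(n choose k)] \<cdot> (x [^] k \<otimes> y [^] (Suc n - k))"
  let ?h' = "\<lambda>k. [(n choose Suc k)] \<cdot> (x [^] Suc k \<otimes> y [^] (n - k))"
  have "finsum R ?f {..n} \<otimes> x = finsum R ?g {..n}"
  proof -
    have "finsum R ?f {..n} \<otimes> x = (\<Oplus>k\<in>{..n}. ?f k \<otimes> x)"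
      using x y by (intro finsum_ldistr) auto
    also have "\<dots> = finsum R ?g {..n}"
    proof (rule finsum_cong')
      fix k
      have "x [^] k \<otimes> y [^] (n - k) \<otimes> x = x [^] Suc k \<otimes> y [^] (n - k)"
        using x y by (simp add: m_ac)
      then show "?f k \<otimes> x = ?g k" using x y by (simp add: add_pow_ldistr)
    qed (use x y in auto)
    finally show ?thesis .
  qed
  moreover have "finsum R ?f {..n} \<otimes> y = ?h 0 \<oplus> finsum R ?h' {..n}"
  proof -
    have "finsum R ?f {..n} \<otimes> y = (\<Oplus>k\<in>{..n}. ?f k \<otimes> y)"
      using x y by (intro finsum_ldistr) auto
    also have "\<dots> = finsum R ?h {..n}"
    proof (rule finsum_cong')
      fix k assume "k \<in> {..n}"
      then have "Suc n - k = Suc (n - k)" by auto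
      then have "x [^] k \<otimes> y [^] (n - k) \<otimes> y = x [^] k \<otimes> y [^] (Suc n - k)"
        using x y by (simp add: m_ac)
      then show "?f k \<otimes> y = ?h k" using x y by (simp add: add_pow_ldistr)
    qed (use x y in auto)
    \<comment> \<open>The added term at \<open>Suc n\<close> is zero since
      \<open>n choose Suc n\<close> is; it makes room for the shift that splits off
      \<open>?h 0\<close>.\<close>
    also have "\<dots> = finsum R ?h {..Suc n}"
      using x y by (subst finsum_Suc) (auto simp: binomial_eq_0)
    also have "\<dots> = finsum R (\<lambda>k. ?h (Suc k)) {..n} \<oplus> ?h 0"
      using x y by (intro finsum_Suc2) auto
    also have "finsum R (\<lambda>k. ?h (Suc k)) {..n} = finsum R ?h' {..n}" by simp
    finally show ?thesis using x y by (subst a_comm) auto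
  qed
  moreover have "finsum R ?g {..n} \<oplus> finsum R ?h' {..n} =
      (\<Oplus>k\<in>{..n}. [(Suc n choose Suc k)] \<cdot> (x [^] Suc k \<otimes> y [^] (Suc n - Suc k)))"
  proof -
    have "finsum R ?g {..n} \<oplus> finsum R ?h' {..n} = (\<Oplus>k\<in>{..n}. ?g k \<oplus> ?h' k)"
      using x y by (subst finsum_addf) auto
    also have "\<dots> = (\<Oplus>k\<in>{..n}. [(Suc n choose Suc k)] \<cdot> (x [^] Suc k \<otimes> y [^] (Suc n - Suc k)))"
      using x y by (intro finsum_cong') (auto simp: add.nat_pow_mult)
    finally show ?thesis .
  qed
  moreover have "(\<Oplus>k\<in>{..Suc n}. [(Suc n choose k)] \<cdot> (x [^] k \<otimes> y [^] (Suc n - k))) =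
    (\<Oplus>k\<in>{..n}. [(Suc n choose Suc k)] \<cdot> (x [^] Suc k \<otimes> y [^] (Suc n - Suc k))) \<oplus> ?h 0"
    using x y by (subst finsum_Suc2) auto
  moreover have "(x \<oplus> y) [^] Suc n = finsum R ?f {..n} \<otimes> x \<oplus> finsum R ?f {..n} \<otimes> y"
    using x y Suc.IH by (simp add: r_distr)
  moreover have "finsum R ?g {..n} \<in> carrier R" "finsum R ?h' {..n} \<in> carrier R" "?h 0 \<in> carrier R"
    using x y by (auto intro!: finsum_closed)
  ultimately show ?case by (metis (lifting) a_assoc a_comm)
qed

text \<open>In the binomial expansion, p divides every coefficient except the two outer ones, and
  multiplication by p is zero.\<close>

lemma (in cring) frobenius_add:
  fixes p :: nat
  assumes p: "prime p" and char: "[p] \<cdot> \<one> = \<zero>" and x: "x \<in> carrier R" and y: "y \<in> carrier R"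
  shows "(x \<oplus> y) [^] p = x [^] p \<oplus> y [^] p"
proof -
  define f where "f k = [(p choose k)] \<cdot> (x [^] k \<otimes> y [^] (p - k))" for k
  have fc: "f k \<in> carrier R" for k using x y by (simp add: f_def)
  \<comment> \<open>With p = m + 2 the middle indices 1, ..., p - 1 are exactly \<open>Suc k\<close>
    for \<open>k \<le> m\<close>, ready for peeling off both ends of the sum.\<close>
  obtain m where m: "p = Suc (Suc m)"
    using prime_ge_2_nat[OF p] that[of "p - 2"] by simp
  have pz: "[p] \<cdot> z = \<zero>" if "z \<in> carrier R" for z
    using add_pow_ldistr[OF one_closed that, of p] that char by simp
  have "f (Suc k) = \<zero>" if "k \<le> m" for k
  proof -
    have "p dvd (p choose Suc k)"
      using that m p by (intro dvd_choose_prime) auto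
    then obtain c where "p choose Suc k = p * c" by blast
    then show ?thesis using x y pz by (simp add: f_def flip: add.nat_pow_pow)
  qed
  then have "finsum R (\<lambda>k. f (Suc k)) {..m} = finsum R (\<lambda>k. \<zero>) {..m}"
    by (intro finsum_cong') auto
  then have "finsum R f {..Suc m} = f 0"
    using fc by (subst finsum_Suc2) auto
  then have "finsum R f {..p} = f p \<oplus> f 0"
    unfolding m using fc by (subst finsum_Suc) auto
  moreover have "f p = x [^] p" "f 0 = y [^] p" using x y by (simp_all add: f_def)
  ultimately show ?thesis using binomial_ring[OF x y, of p, folded f_def] by simp
qed

lemma (in domain) nat_pow_eq_zeroD:
  assumes "x \<in> carrier R" "x [^] (n::nat) = \<zero>"
  shows "x = \<zero>"
  using assms by (induction n) (auto simp: integral_iff)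

text \<open>The p-th power of x - y is zero, and a domain has no nonzero nilpotents. This yields
  uniqueness of p-th roots.\<close>

lemma (in domain) frobenius_inj:
  fixes p :: nat
  assumes p: "prime p" and char: "[p] \<cdot> \<one> = \<zero>" and x: "x \<in> carrier R" and y: "y \<in> carrier R"
    and eq: "x [^] p = y [^] p"
  shows "x = y"
proof -
  have "x [^] p = (x \<ominus> y \<oplus> y) [^] p" using x y by (simp add: minus_eq a_assoc l_neg)
  also have "\<dots> = (x \<ominus> y) [^] p \<oplus> y [^] p" using x y by (intro frobenius_add p char) auto
  finally have "(x \<ominus> y) [^] p = \<zero>"
    using x y eq by (metis add.r_cancel_one' minus_closed nat_pow_closed)
  then have "x \<ominus> y = \<zero>" using nat_pow_eq_zeroD x y minus_closed by blast
  then show ?thesis using x y by simp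
qed

section \<open>Equations of implicitly closed fields\<close>

text \<open>Negation is not carried over: \<open>a_inv\<close> is derived from addition, and a law
  for \<open>icneg\<close> in \<open>ic_equations\<close> ties the two together.\<close>

definition ring_of :: "'a icalg \<Rightarrow> 'a ring" where
  "ring_of A = \<lparr> carrier = icarrier A, monoid.mult = icmul A, one = icone A, zero = iczero A, add = icadd A \<rparr>"

lemma ring_of_simps [simp]:
  "carrier (ring_of A) = icarrier A" "monoid.mult (ring_of A) = icmul A" "monoid.one (ring_of A) = icone A"
  "ring.zero (ring_of A) = iczero A" "ring.add (ring_of A) = icadd A"
  by (simp_all add: ring_of_def)

section \<open>Closure, homomorphisms, numerals and powers in the full signature\<close>

lemma ic_algebraD:
  assumes "ic_algebra A"
  shows "iczero A \<in> icarrier A" "icone A \<in> icarrier A"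
    "x \<in> icarrier A \<Longrightarrow> y \<in> icarrier A \<Longrightarrow> icadd A x y \<in> icarrier A"
    "x \<in> icarrier A \<Longrightarrow> y \<in> icarrier A \<Longrightarrow> icmul A x y \<in> icarrier A"
    "x \<in> icarrier A \<Longrightarrow> icneg A x \<in> icarrier A"
    "x \<in> icarrier A \<Longrightarrow> icinv A x \<in> icarrier A"
    "prime p \<Longrightarrow> x \<in> icarrier A \<Longrightarrow> icroot A p x \<in> icarrier A"
  using assms by (auto simp: ic_algebra_def ic_closed_def)

lemma ic_homD:
  assumes "ic_hom A B h"
  shows "x \<in> icarrier A \<Longrightarrow> h x \<in> icarrier B" "h (iczero A) = iczero B" "h (icone A) = icone B"
    "x \<in> icarrier A \<Longrightarrow> y \<in> icarrier A \<Longrightarrow> h (icadd A x y) = icadd B (h x) (h y)"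
    "x \<in> icarrier A \<Longrightarrow> y \<in> icarrier A \<Longrightarrow> h (icmul A x y) = icmul B (h x) (h y)"
    "x \<in> icarrier A \<Longrightarrow> h (icneg A x) = icneg B (h x)"
    "x \<in> icarrier A \<Longrightarrow> h (icinv A x) = icinv B (h x)"
    "prime p \<Longrightarrow> x \<in> icarrier A \<Longrightarrow> h (icroot A p x) = icroot B p (h x)"
  using assms by (auto simp: ic_hom_def)

lemma ic_natone_closed: "ic_algebra A \<Longrightarrow> ic_natone A n \<in> icarrier A"
  by (induction n) (auto simp: ic_algebraD)

lemma ic_pow_closed: "ic_algebra A \<Longrightarrow> x \<in> icarrier A \<Longrightarrow> ic_pow A x n \<in> icarrier A"
  by (induction n) (auto simp: ic_algebraD)

lemma ic_hom_natone: "ic_algebra A \<Longrightarrow> ic_hom A B h \<Longrightarrow> h (ic_natone A n) = ic_natone B n"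
  by (induction n) (auto simp: ic_homD ic_algebraD ic_natone_closed)

lemma ic_hom_pow:
  "ic_algebra A \<Longrightarrow> ic_hom A B h \<Longrightarrow> x \<in> icarrier A \<Longrightarrow> h (ic_pow A x n) = ic_pow B (h x) n"
  by (induction n) (auto simp: ic_homD ic_algebraD ic_pow_closed)

lemma ic_hom_ring_hom: "ic_hom A B h \<Longrightarrow> h \<in> ring_hom (ring_of A) (ring_of B)"
  by (rule ring_hom_memI) (auto simp: ic_homD)

lemma ic_natone_eq: "ic_natone A n = [n] \<cdot>\<^bsub>ring_of A\<^esub> icone A"
  by (induction n) (auto simp: add_pow_def nat_pow_def)

lemma ic_pow_eq: "ic_pow A x n = x [^]\<^bsub>ring_of A\<^esub> n"
  by (induction n) (auto simp: nat_pow_def)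

text \<open>The last equation is \<open>r\<^sub>p(x)\<^sup>p = (1 - p p\<^sup>*) x\<close>, arranged without subtraction.\<close>
definition ic_equations :: "'a icalg \<Rightarrow> bool" where
  "ic_equations A \<longleftrightarrow> ic_algebra A \<and> cring (ring_of A) \<and>
     (\<forall>x\<in>icarrier A. icadd A (icneg A x) x = iczero A \<and>
        icmul A (icmul A x (icinv A x)) x = x \<and>
        icmul A (icmul A (icinv A x) x) (icinv A x) = icinv A x) \<and>
     (\<forall>p. prime p \<longrightarrow> (\<forall>x\<in>icarrier A.
        icmul A (ic_natone A p) (icroot A p x) = iczero A \<and>
        icadd A (ic_pow A (icroot A p x) p)
          (icmul A (icmul A (ic_natone A p) (icinv A (ic_natone A p))) x) = x))"

lemma ic_field_field:
  assumes "ic_field F" shows "field (ring_of F)"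
proof -
  note F = assms[unfolded ic_field_def]
  have clos: "iczero F \<in> icarrier F" "icone F \<in> icarrier F"
    "x \<in> icarrier F \<Longrightarrow> y \<in> icarrier F \<Longrightarrow> icadd F x y \<in> icarrier F"
    "x \<in> icarrier F \<Longrightarrow> y \<in> icarrier F \<Longrightarrow> icmul F x y \<in> icarrier F"
    "x \<in> icarrier F \<Longrightarrow> icneg F x \<in> icarrier F" for x y
    using F by blast+
  have comm: "icadd F x y = icadd F y x" "icmul F x y = icmul F y x"
    if "x \<in> icarrier F" "y \<in> icarrier F" for x y
    using F that by blast+
  have right: "icadd F x (iczero F) = x" "icadd F x (icneg F x) = iczero F" "icmul F x (icone F) = x"
    if "x \<in> icarrier F" for x
    using F that by blast+
  have assoc: "icadd F (icadd F x y) z = icadd F x (icadd F y z)"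
    "icmul F (icmul F x y) z = icmul F x (icmul F y z)"
    "icmul F x (icadd F y z) = icadd F (icmul F x y) (icmul F x z)"
    if "x \<in> icarrier F" "y \<in> icarrier F" "z \<in> icarrier F" for x y z
    using F that by blast+
  have left: "icadd F (iczero F) x = x" "icadd F (icneg F x) x = iczero F" "icmul F (icone F) x = x"
    if "x \<in> icarrier F" for x
    using right[OF that] comm[OF _ that] clos that by metis+
  have distr: "icmul F (icadd F x y) z = icadd F (icmul F x z) (icmul F y z)"
    if "x \<in> icarrier F" "y \<in> icarrier F" "z \<in> icarrier F" for x y z
    using assoc(3)[of z x y] comm clos that by metis
  have "cring (ring_of F)"
  proof (rule cringI)
    show "abelian_group (ring_of F)"
    proof (rule abelian_groupI)
      fix x assume "x \<in> carrier (ring_of F)"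
      then show "\<exists>y\<in>carrier (ring_of F). y \<oplus>\<^bsub>ring_of F\<^esub> x = \<zero>\<^bsub>ring_of F\<^esub>"
        using left clos by (intro bexI[of _ "icneg F x"]) auto
    qed (auto simp: clos left assoc intro: comm)
    show "Group.comm_monoid (ring_of F)"
      by (rule comm_monoidI) (auto simp: clos left assoc intro: comm)
  qed (simp add: distr)
  then show ?thesis
    by (rule cring.cring_fieldI2) (use F in auto)
qed

text \<open>The ring laws in the vocabulary of \<open>icalg\<close>, the form in which they are
  pulled back from coordinate fields.\<close>

lemma cring_ring_ofD:
  assumes "cring (ring_of A)"
  shows "x \<in> icarrier A \<Longrightarrow> y \<in> icarrier A \<Longrightarrow> icadd A x y = icadd A y x"
    "x \<in> icarrier A \<Longrightarrow> y \<in> icarrier A \<Longrightarrow> icmul A x y = icmul A y x"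
    "x \<in> icarrier A \<Longrightarrow> icadd A (iczero A) x = x" "x \<in> icarrier A \<Longrightarrow> icmul A (icone A) x = x"
    "x \<in> icarrier A \<Longrightarrow> y \<in> icarrier A \<Longrightarrow> z \<in> icarrier A \<Longrightarrow>
      icadd A (icadd A x y) z = icadd A x (icadd A y z)"
    "x \<in> icarrier A \<Longrightarrow> y \<in> icarrier A \<Longrightarrow> z \<in> icarrier A \<Longrightarrow>
      icmul A (icmul A x y) z = icmul A x (icmul A y z)"
    "x \<in> icarrier A \<Longrightarrow> y \<in> icarrier A \<Longrightarrow> z \<in> icarrier A \<Longrightarrow>
      icmul A (icadd A x y) z = icadd A (icmul A x z) (icmul A y z)"
proof -
  interpret cring "ring_of A" by fact
  show "x \<in> icarrier A \<Longrightarrow> y \<in> icarrier A \<Longrightarrow> icadd A x y = icadd A y x"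
    using a_comm by simp
  show "x \<in> icarrier A \<Longrightarrow> y \<in> icarrier A \<Longrightarrow> icmul A x y = icmul A y x"
    using m_comm by simp
  show "x \<in> icarrier A \<Longrightarrow> icadd A (iczero A) x = x" using l_zero by simp
  show "x \<in> icarrier A \<Longrightarrow> icmul A (icone A) x = x" using l_one by simp
  show "x \<in> icarrier A \<Longrightarrow> y \<in> icarrier A \<Longrightarrow> z \<in> icarrier A \<Longrightarrow>
      icadd A (icadd A x y) z = icadd A x (icadd A y z)" using a_assoc by simp
  show "x \<in> icarrier A \<Longrightarrow> y \<in> icarrier A \<Longrightarrow> z \<in> icarrier A \<Longrightarrow>
      icmul A (icmul A x y) z = icmul A x (icmul A y z)" using m_assoc by simp
  show "x \<in> icarrier A \<Longrightarrow> y \<in> icarrier A \<Longrightarrow> z \<in> icarrier A \<Longrightarrow>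
      icmul A (icadd A x y) z = icadd A (icmul A x z) (icmul A y z)" using l_distr by simp
qed

text \<open>For the root laws: in characteristic p the numeral p is 0, so the correction term
  vanishes and the power of the root is \<open>x\<close>. Otherwise the root is 0 and p times its
  weak inverse is 1, so the correction term alone gives \<open>x\<close>.\<close>

lemma implicitly_closed_field_equations:
  assumes "implicitly_closed_field F" shows "ic_equations F"
proof -
  note F = assms[unfolded implicitly_closed_field_def]
  have fld: "ic_field F" using F by (simp add: weakly_rooted_def)
  interpret field "ring_of F" by (rule ic_field_field[OF fld])
  have ops: "icadd F = (\<oplus>\<^bsub>ring_of F\<^esub>)" "icmul F = (\<otimes>\<^bsub>ring_of F\<^esub>)" "iczero F = \<zero>\<^bsub>ring_of F\<^esub>"
    "icone F = \<one>\<^bsub>ring_of F\<^esub>" by simp_all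
  have alg: "ic_algebra F"
    using F fld unfolding ic_algebra_def ic_closed_def ic_field_def by blast
  have neg: "icadd F (icneg F x) x = iczero F" if "x \<in> icarrier F" for x
    using fld that unfolding ic_field_def by metis
  have inv0: "icinv F (iczero F) = iczero F" using F fld unfolding ic_field_def by blast
  have inv1: "icmul F x (icinv F x) = icone F" if "x \<in> icarrier F" "x \<noteq> iczero F" for x
    using F that by blast
  have inv2: "icmul F (icinv F x) x = icone F" if "x \<in> icarrier F" "x \<noteq> iczero F" for x
    using inv1[OF that] m_comm[of x "icinv F x"] that ic_algebraD(6)[OF alg] by simp
  have inv: "icmul F (icmul F x (icinv F x)) x = x \<and>
      icmul F (icmul F (icinv F x) x) (icinv F x) = icinv F x" if x: "x \<in> icarrier F" for x
  proof (cases "x = iczero F")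
    case True
    then show ?thesis using l_null[of "iczero F"] ic_algebraD(1)[OF alg] by (simp add: inv0)
  next
    case False
    then show ?thesis
      using inv1[OF x] inv2[OF x] x l_one[of x] l_one[of "icinv F x"] ic_algebraD(6)[OF alg x] by simp
  qed
  have root: "icmul F (ic_natone F p) (icroot F p x) = iczero F \<and>
        icadd F (ic_pow F (icroot F p x) p)
          (icmul F (icmul F (ic_natone F p) (icinv F (ic_natone F p))) x) = x"
    if p: "prime p" and x: "x \<in> icarrier F" for p x
  proof (cases "ic_charp F p")
    case True
    then have "ic_natone F p = iczero F" "ic_pow F (icroot F p x) p = x"
      using F p x by (auto simp: ic_charp_def)
    then show ?thesis
      using x ic_algebraD(1,7)[OF alg] p l_null[of "icroot F p x"] l_null[of "iczero F"] l_null[of x] r_zero[of x]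
      by (simp add: inv0)
  next
    case False
    have n: "ic_natone F p \<in> icarrier F" by (rule ic_natone_closed[OF alg])
    have "ic_natone F p \<noteq> iczero F" using False p by (simp add: ic_charp_def)
    then have 1: "icmul F (ic_natone F p) (icinv F (ic_natone F p)) = icone F" using inv1 n by blast
    have r: "icroot F p x = iczero F" using F p x False by auto
    have "p \<noteq> 0" using p by auto
    then have "ic_pow F (iczero F) p = iczero F"
      unfolding ic_pow_eq using nat_pow_zero by simp
    then show ?thesis unfolding 1 r using n x r_null[of "ic_natone F p"] l_zero[of x] l_one[of x] by simp
  qed
  show ?thesis
    unfolding ic_equations_def using alg is_cring neg inv root by blast
qed

text \<open>The coordinates of a representation in a product. That they jointly separate points
  reduces identities in \<open>A\<close> to identities in fields.\<close>

lemma ICM_coordinates: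
  assumes "ICM A TYPE('i) TYPE('f)"
  obtains I :: "'i set" and F :: "'i \<Rightarrow> 'f icalg" and \<phi> where
    "\<And>i. i \<in> I \<Longrightarrow> implicitly_closed_field (F i)" "\<And>i. i \<in> I \<Longrightarrow> ic_hom A (F i) (\<phi> i)"
    "\<And>x y. x \<in> icarrier A \<Longrightarrow> y \<in> icarrier A \<Longrightarrow> (\<And>i. i \<in> I \<Longrightarrow> \<phi> i x = \<phi> i y) \<Longrightarrow> x = y"
proof -
  obtain I :: "'i set" and F :: "'i \<Rightarrow> 'f icalg" and S h where
    F: "\<And>i. i \<in> I \<Longrightarrow> implicitly_closed_field (F i)" and h: "ic_hom A (ic_product I F) h"
    and bij: "bij_betw h (icarrier A) S"
    using assms unfolding ICM_def by blast
  note hD = ic_homD[OF h]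
  have hP: "h x \<in> PiE I (\<lambda>i. icarrier (F i))" if "x \<in> icarrier A" for x
    using hD(1)[OF that] by (simp add: ic_product_def)
  show ?thesis
  proof (rule that[of I F "\<lambda>i x. h x i"])
    fix i assume i: "i \<in> I"
    show "ic_hom A (F i) (\<lambda>x. h x i)"
      unfolding ic_hom_def using hP i hD(2-) by (auto simp: ic_product_def)
  next
    fix x y assume xy: "x \<in> icarrier A" "y \<in> icarrier A" "\<And>i. i \<in> I \<Longrightarrow> h x i = h y i"
    then have "h x = h y" using hP[of x] hP[of y] by (intro PiE_ext) auto
    then show "x = y" using bij xy by (auto simp: bij_betw_def inj_on_def)
  qed (use F in auto)
qed

text \<open>Identities pass from the fields to products and subalgebras. Through these identities
  alone does membership of \<open>A\<close>, \<open>B\<close> and \<open>C\<close> in the class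
  enter the amalgamation.\<close>

lemma ICM_equations:
  assumes "ICM A TYPE('i) TYPE('f)" shows "ic_equations A"
proof -
  have alg: "ic_algebra A" using assms by (simp add: ICM_def)
  obtain I :: "'i set" and F :: "'i \<Rightarrow> 'f icalg" and \<phi> where
    F: "\<And>i. i \<in> I \<Longrightarrow> implicitly_closed_field (F i)" and \<phi>: "\<And>i. i \<in> I \<Longrightarrow> ic_hom A (F i) (\<phi> i)"
    and eqI: "\<And>x y. x \<in> icarrier A \<Longrightarrow> y \<in> icarrier A \<Longrightarrow> (\<And>i. i \<in> I \<Longrightarrow> \<phi> i x = \<phi> i y) \<Longrightarrow> x = y"
    using assms by (rule ICM_coordinates) blast
  note clos = ic_algebraD[OF alg] ic_natone_closed[OF alg] ic_pow_closed[OF alg]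
  note hom = ic_homD[OF \<phi>] ic_hom_natone[OF alg \<phi>] ic_hom_pow[OF alg \<phi>]
  have eqs: "ic_equations (F i)" if "i \<in> I" for i using F that implicitly_closed_field_equations by blast
  have cr: "cring (ring_of (F i))" if "i \<in> I" for i using eqs[OF that] by (simp add: ic_equations_def)
  note laws = cring_ring_ofD[OF cr]
  have neg: "icadd A (icneg A x) x = iczero A" if "x \<in> icarrier A" for x
    using that eqs by (intro eqI) (auto simp: clos hom ic_equations_def)
  have "cring (ring_of A)"
  proof (rule cringI)
    show "abelian_group (ring_of A)"
    proof (rule abelian_groupI)
      fix x assume "x \<in> carrier (ring_of A)"
      then show "\<exists>y\<in>carrier (ring_of A). y \<oplus>\<^bsub>ring_of A\<^esub> x = \<zero>\<^bsub>ring_of A\<^esub>"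
        using neg clos by (intro bexI[of _ "icneg A x"]) auto
    qed (auto intro!: eqI simp: clos hom laws(3,5) intro!: laws(1))
    show "Group.comm_monoid (ring_of A)"
      by (rule comm_monoidI) (auto intro!: eqI simp: clos hom laws(4,6) intro!: laws(2))
  qed (auto intro!: eqI simp: clos hom laws(7))
  moreover have "icmul A (icmul A x (icinv A x)) x = x"
    "icmul A (icmul A (icinv A x) x) (icinv A x) = icinv A x" if "x \<in> icarrier A" for x
    using that eqs by (auto intro!: eqI simp: clos hom ic_equations_def)
  moreover have "icmul A (ic_natone A p) (icroot A p x) = iczero A"
    "icadd A (ic_pow A (icroot A p x) p)
          (icmul A (icmul A (ic_natone A p) (icinv A (ic_natone A p))) x) = x"
    if "prime p" "x \<in> icarrier A" for p x
    using that eqs by (auto intro!: eqI simp: clos hom ic_equations_def)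
  ultimately show ?thesis unfolding ic_equations_def using alg neg by blast
qed

section \<open>Fields as implicitly closed fields\<close>

text \<open>When p-th roots exist, the choice made by \<open>SOME\<close> is forced:
  \<open>frobenius_inj\<close> makes them unique in characteristic p. This is why ring homomorphisms
  will respect \<open>icroot\<close>.\<close>

definition icalg_of :: "'f ring \<Rightarrow> 'f icalg" where
  "icalg_of F = \<lparr> icarrier = carrier F, icadd = ring.add F, icmul = monoid.mult F, icneg = a_inv F,
     iczero = ring.zero F, icone = monoid.one F,
     icinv = (\<lambda>x. if x = \<zero>\<^bsub>F\<^esub> then \<zero>\<^bsub>F\<^esub> else inv\<^bsub>F\<^esub> x),
     icroot = (\<lambda>p x. if prime p \<and> [p] \<cdot>\<^bsub>F\<^esub> \<one>\<^bsub>F\<^esub> = \<zero>\<^bsub>F\<^esub>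
       then SOME y. y \<in> carrier F \<and> y [^]\<^bsub>F\<^esub> p = x else \<zero>\<^bsub>F\<^esub>) \<rparr>"

lemma icalg_of_simps [simp]:
  "icarrier (icalg_of F) = carrier F" "icadd (icalg_of F) = ring.add F"
  "icmul (icalg_of F) = monoid.mult F" "icneg (icalg_of F) = a_inv F"
  "iczero (icalg_of F) = ring.zero F" "icone (icalg_of F) = monoid.one F"
  by (simp_all add: icalg_of_def)

lemma ring_of_icalg_of [simp]: "ring_of (icalg_of F) = F"
  by (simp add: ring_of_def)

text \<open>The least positive n with n 1 = 0 is prime, since a proper factorization would give a
  smaller one. It supplies the alternative to \<open>ic_char0\<close> in
  \<open>weakly_rooted\<close>.\<close>

lemma (in domain) char_prime:
  fixes n :: nat
  assumes "n > 0" "[n] \<cdot> \<one> = \<zero>"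
  shows "\<exists>p::nat. prime p \<and> [p] \<cdot> \<one> = \<zero>"
proof -
  define p where "p = (LEAST n::nat. n > 0 \<and> [n] \<cdot> \<one> = \<zero>)"
  have p: "p > 0" "[p] \<cdot> \<one> = \<zero>"
    using LeastI[of "\<lambda>n::nat. n > 0 \<and> [n] \<cdot> \<one> = \<zero>" n] assms by (auto simp: p_def)
  have least: "[m] \<cdot> \<one> \<noteq> \<zero>" if "0 < m" "m < p" for m :: nat
    using not_less_Least[of m "\<lambda>n. n > 0 \<and> [n] \<cdot> \<one> = \<zero>"] that by (auto simp: p_def)
  have "prime p"
    unfolding prime_nat_iff
  proof (intro conjI allI impI)
    have "p \<noteq> 1" using p by auto
    then show "1 < p" using p by simp
    fix m assume "m dvd p"
    then obtain k where k: "p = m * k" by blast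
    have "([m] \<cdot> \<one>) \<otimes> ([k] \<cdot> \<one>) = [p] \<cdot> \<one>"
      unfolding k by (simp add: add_pow_ldistr add_pow_rdistr add.nat_pow_pow mult.commute)
    then have "[m] \<cdot> \<one> = \<zero> \<or> [k] \<cdot> \<one> = \<zero>"
      using p by (simp add: integral_iff)
    then have "\<not> (0 < m \<and> m < p) \<or> \<not> (0 < k \<and> k < p)" using least by blast
    then show "m = 1 \<or> m = p" using k p by (cases m; cases k; auto)
  qed
  then show ?thesis using p by blast
qed

lemma implicitly_closed_field_icalg_of:
  assumes "field F"
    and perfect: "\<And>(p::nat) x. prime p \<Longrightarrow> [p] \<cdot>\<^bsub>F\<^esub> \<one>\<^bsub>F\<^esub> = \<zero>\<^bsub>F\<^esub> \<Longrightarrow> x \<in> carrier F \<Longrightarrow>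
      \<exists>y\<in>carrier F. y [^]\<^bsub>F\<^esub> p = x"
  shows "implicitly_closed_field (icalg_of F)"
proof -
  interpret field F by fact
  have one: "ic_natone (icalg_of F) n = [n] \<cdot>\<^bsub>F\<^esub> \<one>\<^bsub>F\<^esub>" for n
    by (simp add: ic_natone_eq)
  have pow: "ic_pow (icalg_of F) x n = x [^]\<^bsub>F\<^esub> n" for x n
    by (simp add: ic_pow_eq)
  have inv: "x \<otimes>\<^bsub>F\<^esub> inv\<^bsub>F\<^esub> x = \<one>\<^bsub>F\<^esub>" "inv\<^bsub>F\<^esub> x \<in> carrier F"
    if "x \<in> carrier F" "x \<noteq> \<zero>\<^bsub>F\<^esub>" for x
    using that field_Units by auto
  have "ic_field (icalg_of F)"
    unfolding ic_field_def
  proof (intro conjI ballI impI)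
    fix x assume "x \<in> icarrier (icalg_of F)" "x \<noteq> iczero (icalg_of F)"
    then show "\<exists>y\<in>icarrier (icalg_of F). icmul (icalg_of F) x y = icone (icalg_of F)"
      using inv[of x] by auto
  qed (auto simp: a_assoc m_assoc r_distr r_neg intro: a_comm m_comm)
  moreover have "ic_char0 (icalg_of F) \<or> (\<exists>p. ic_charp (icalg_of F) p \<and>
      (\<forall>a\<in>icarrier (icalg_of F). \<exists>b\<in>icarrier (icalg_of F). ic_pow (icalg_of F) b p = a))"
    unfolding ic_char0_def ic_charp_def one pow icalg_of_simps using char_prime perfect by blast
  ultimately have "weakly_rooted (icalg_of F)" by (simp add: weakly_rooted_def)
  moreover have "(SOME y. y \<in> carrier F \<and> y [^]\<^bsub>F\<^esub> p = x) \<in> carrier F \<and>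
      (SOME y. y \<in> carrier F \<and> y [^]\<^bsub>F\<^esub> p = x) [^]\<^bsub>F\<^esub> p = x"
    if "prime p" "[p] \<cdot>\<^bsub>F\<^esub> \<one>\<^bsub>F\<^esub> = \<zero>\<^bsub>F\<^esub>" "x \<in> carrier F" for p :: nat and x
    using someI_ex[of "\<lambda>y. y \<in> carrier F \<and> y [^]\<^bsub>F\<^esub> p = x"] perfect[OF that] by blast
  ultimately show ?thesis
    unfolding implicitly_closed_field_def
    using inv by (auto simp: icalg_of_def ic_charp_def one[unfolded icalg_of_def] pow[unfolded icalg_of_def])
qed

section \<open>Ring homomorphisms into fields respect the full signature\<close>

lemma ring_hom_natone:
  assumes "ic_algebra B" "g \<in> ring_hom (ring_of B) F" "g (iczero B) = \<zero>\<^bsub>F\<^esub>"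
  shows "g (ic_natone B n) = [n] \<cdot>\<^bsub>F\<^esub> \<one>\<^bsub>F\<^esub>"
proof (induction n)
  case 0
  then show ?case using assms(3) by (simp add: add_pow_def)
next
  case (Suc n)
  have "g (icadd B (ic_natone B n) (icone B)) = g (ic_natone B n) \<oplus>\<^bsub>F\<^esub> g (icone B)"
    using ring_hom_add[OF assms(2)] ic_natone_closed[OF assms(1)] ic_algebraD(2)[OF assms(1)] by simp
  then show ?case using Suc ring_hom_one[OF assms(2)] by (simp add: add_pow_def nat_pow_def)
qed

lemma ring_hom_ic_pow:
  assumes "ic_algebra B" "g \<in> ring_hom (ring_of B) F" "x \<in> icarrier B"
  shows "g (ic_pow B x n) = g x [^]\<^bsub>F\<^esub> n"
proof (induction n)
  case 0
  then show ?case using ring_hom_one[OF assms(2)] by simp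
next
  case (Suc n)
  then show ?case
    using ring_hom_mult[OF assms(2)] ic_pow_closed[OF assms(1,3)] assms(3) by (simp add: nat_pow_def)
qed

text \<open>Apply \<open>g\<close> to the two root laws. If p is nonzero in \<open>F\<close>, then p
  g(r) = 0 forces g(r) = 0; if p is 0 there, the correction term disappears. The first case also
  provides p-th roots for the generators of the amalgamating field.\<close>

lemma ring_hom_icroot:
  assumes B: "ic_equations B" and "field F" and g: "g \<in> ring_hom (ring_of B) F"
    and p: "prime p" and x: "x \<in> icarrier B"
  shows "[p] \<cdot>\<^bsub>F\<^esub> \<one>\<^bsub>F\<^esub> = \<zero>\<^bsub>F\<^esub> \<Longrightarrow> g (icroot B p x) [^]\<^bsub>F\<^esub> p = g x"
    "[p] \<cdot>\<^bsub>F\<^esub> \<one>\<^bsub>F\<^esub> \<noteq> \<zero>\<^bsub>F\<^esub> \<Longrightarrow> g (icroot B p x) = \<zero>\<^bsub>F\<^esub>"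
proof -
  interpret field F by fact
  have alg: "ic_algebra B" and cr: "cring (ring_of B)" using B by (auto simp: ic_equations_def)
  interpret g: ring_hom_cring "ring_of B" F g
    using cr g is_cring by (simp add: ring_hom_cring_def ring_hom_cring_axioms_def)
  have eq: "icmul B (ic_natone B p) (icroot B p x) = iczero B"
    "icadd B (ic_pow B (icroot B p x) p)
       (icmul B (icmul B (ic_natone B p) (icinv B (ic_natone B p))) x) = x"
    using B p x by (auto simp: ic_equations_def)
  define n where "n = ic_natone B p"
  define r where "r = icroot B p x"
  have c: "n \<in> icarrier B" "r \<in> icarrier B" "icinv B n \<in> icarrier B" "ic_pow B r p \<in> icarrier B"
    using alg p x by (auto simp: n_def r_def ic_algebraD ic_natone_closed ic_pow_closed)
  have cF: "g n \<in> carrier F" "g r \<in> carrier F" "g (icinv B n) \<in> carrier F" "g x \<in> carrier F"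
    using c x g.hom_closed by auto
  have gn: "g n = [p] \<cdot>\<^bsub>F\<^esub> \<one>\<^bsub>F\<^esub>"
    unfolding n_def using g.hom_zero by (intro ring_hom_natone[OF alg g]) simp
  have "g n \<otimes>\<^bsub>F\<^esub> g r = \<zero>\<^bsub>F\<^esub>"
    using eq(1) g.hom_mult[of n r] g.hom_zero c by (simp add: n_def r_def)
  then show "[p] \<cdot>\<^bsub>F\<^esub> \<one>\<^bsub>F\<^esub> \<noteq> \<zero>\<^bsub>F\<^esub> \<Longrightarrow> g (icroot B p x) = \<zero>\<^bsub>F\<^esub>"
    using cF integral[of "g n" "g r"] by (auto simp: gn r_def)
  have "g (icadd B (ic_pow B r p) (icmul B (icmul B n (icinv B n)) x)) =
      g r [^]\<^bsub>F\<^esub> p \<oplus>\<^bsub>F\<^esub> (g n \<otimes>\<^bsub>F\<^esub> g (icinv B n)) \<otimes>\<^bsub>F\<^esub> g x"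
    using c x alg g.hom_add[of "ic_pow B r p" "icmul B (icmul B n (icinv B n)) x"]
      g.hom_mult[of "icmul B n (icinv B n)" x] g.hom_mult[of n "icinv B n"]
    by (simp add: ring_hom_ic_pow[OF alg g] ic_algebraD)
  then show "g (icroot B p x) [^]\<^bsub>F\<^esub> p = g x" if "[p] \<cdot>\<^bsub>F\<^esub> \<one>\<^bsub>F\<^esub> = \<zero>\<^bsub>F\<^esub>"
    using eq(2) cF that by (simp add: gn flip: n_def r_def)
qed

lemma ring_hom_ic_hom:
  assumes B: "ic_equations B" and "field F" and g: "g \<in> ring_hom (ring_of B) F"
  shows "ic_hom B (icalg_of F) g"
proof -
  interpret field F by fact
  have alg: "ic_algebra B" and cr: "cring (ring_of B)" using B by (auto simp: ic_equations_def)
  interpret g: ring_hom_cring "ring_of B" F g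
    using cr g is_cring by (simp add: ring_hom_cring_def ring_hom_cring_axioms_def)
  note clos = ic_algebraD[OF alg]
  have hom: "g (icadd B x y) = g x \<oplus>\<^bsub>F\<^esub> g y" "g (icmul B x y) = g x \<otimes>\<^bsub>F\<^esub> g y" "g x \<in> carrier F"
    if "x \<in> icarrier B" "y \<in> icarrier B" for x y
    using that g.hom_add g.hom_mult g.hom_closed by auto
  have one: "g (icone B) = \<one>\<^bsub>F\<^esub>" and zero: "g (iczero B) = \<zero>\<^bsub>F\<^esub>"
    using g.hom_one g.hom_zero by auto
  have neg: "g (icneg B x) = \<ominus>\<^bsub>F\<^esub> g x" if x: "x \<in> icarrier B" for x
  proof -
    have "icadd B (icneg B x) x = iczero B" using B x by (simp add: ic_equations_def)
    then have "g (icneg B x) \<oplus>\<^bsub>F\<^esub> g x = \<zero>\<^bsub>F\<^esub>" using hom(1)[of "icneg B x" x] x clos zero by simp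
    then show ?thesis using hom(3) x clos by (intro minus_equality[symmetric]) auto
  qed
  have inv: "g (icinv B x) = icinv (icalg_of F) (g x)" if x: "x \<in> icarrier B" for x
  proof -
    have x': "icinv B x \<in> icarrier B" using x clos by simp
    have c: "g x \<in> carrier F" "g (icinv B x) \<in> carrier F" using x x' hom by auto
    have eq: "icmul B (icmul B x (icinv B x)) x = x"
      "icmul B (icmul B (icinv B x) x) (icinv B x) = icinv B x"
      using B x by (auto simp: ic_equations_def)
    have e1: "g x \<otimes>\<^bsub>F\<^esub> g (icinv B x) \<otimes>\<^bsub>F\<^esub> g x = g x"
      using arg_cong[OF eq(1), of g] x x' clos by (simp add: hom)
    have e2: "g (icinv B x) \<otimes>\<^bsub>F\<^esub> g x \<otimes>\<^bsub>F\<^esub> g (icinv B x) = g (icinv B x)"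
      using arg_cong[OF eq(2), of g] x x' clos by (simp add: hom)
    show ?thesis
    \<comment> \<open>At g x = 0 the second law makes the image of the weak inverse 0; otherwise
      cancelling g x in the first law makes it the inverse.\<close>
    proof (cases "g x = \<zero>\<^bsub>F\<^esub>")
      case True
      then show ?thesis using e2 c by (simp add: icalg_of_def)
    next
      case False
      have "g x \<otimes>\<^bsub>F\<^esub> g (icinv B x) \<otimes>\<^bsub>F\<^esub> g x = \<one>\<^bsub>F\<^esub> \<otimes>\<^bsub>F\<^esub> g x" using e1 c by simp
      then have "g x \<otimes>\<^bsub>F\<^esub> g (icinv B x) = \<one>\<^bsub>F\<^esub>"
        using False c m_rcancel[of "g x" "g x \<otimes>\<^bsub>F\<^esub> g (icinv B x)" "\<one>\<^bsub>F\<^esub>"] by simp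
      then have "inv\<^bsub>F\<^esub> (g x) = g (icinv B x)" using c by (intro comm_inv_char) auto
      then show ?thesis using False by (simp add: icalg_of_def)
    qed
  qed
  have root: "g (icroot B p x) = icroot (icalg_of F) p (g x)" if p: "prime p" and x: "x \<in> icarrier B" for p x
  proof (cases "[p] \<cdot>\<^bsub>F\<^esub> \<one>\<^bsub>F\<^esub> = \<zero>\<^bsub>F\<^esub>")
    case True
    have r: "g (icroot B p x) \<in> carrier F" "g (icroot B p x) [^]\<^bsub>F\<^esub> p = g x"
      using ring_hom_icroot(1)[OF B \<open>field F\<close> g p x True] hom(3) clos p x by simp_all
    define y where "y = (SOME y. y \<in> carrier F \<and> y [^]\<^bsub>F\<^esub> p = g x)"
    have "y \<in> carrier F \<and> y [^]\<^bsub>F\<^esub> p = g x" unfolding y_def using r by (intro someI conjI)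
    then have y: "y \<in> carrier F" "y [^]\<^bsub>F\<^esub> p = g x" by auto
    have "g (icroot B p x) = y" by (rule frobenius_inj[OF p True r(1) y(1)]) (simp only: r(2) y(2))
    then show ?thesis using p True by (simp add: icalg_of_def y_def)
  next
    case False
    then show ?thesis using ring_hom_icroot(2)[OF B \<open>field F\<close> g p x False] by (simp add: icalg_of_def)
  qed
  show ?thesis
    unfolding ic_hom_def using hom one zero neg inv root by simp
qed

text \<open>The roles are asymmetric: survival of an element of \<open>B\<close> rests on the
  injectivity of \<open>h2\<close>. Elements of \<open>C\<close> are handled by exchanging
  \<open>B\<close> and \<open>C\<close>.\<close>

lemma exists_amalgamating_implicitly_closed_field:
  fixes A :: "'a icalg" and B :: "'b icalg" and C :: "'c icalg"
  assumes A: "ic_equations A" and B: "ic_equations B" and C: "ic_equations C"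
    and h1: "ic_hom A B h1" and h2: "ic_embedding A C h2"
    and b: "b \<in> icarrier B" "b \<noteq> iczero B"
  obtains F :: "(('b \<Rightarrow> 'c set) \<Rightarrow> 'b \<Rightarrow> 'c set) set icalg" and g1 :: "'b \<Rightarrow> _" and g2 :: "'c \<Rightarrow> _"
  where "implicitly_closed_field F" "ic_hom B F g1" "ic_hom C F g2"
    "\<And>a. a \<in> icarrier A \<Longrightarrow> g1 (h1 a) = g2 (h2 a)" "g1 b \<noteq> iczero F"
proof -
  have cr: "cring (ring_of A)" "cring (ring_of B)" "cring (ring_of C)"
    and algA: "ic_algebra A" and algB: "ic_algebra B" and algC: "ic_algebra C"
    using A B C by (auto simp: ic_equations_def)
  interpret B: cring "ring_of B" by (rule cr)
  \<comment> \<open>An idempotent with e b = b, hence nonzero along with \<open>b\<close>. Sending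
    it to 1 makes the image of \<open>b\<close> invertible.\<close>
  define e where "e = icmul B b (icinv B b)"
  have b': "icinv B b \<in> icarrier B" using algB b by (simp add: ic_algebraD)
  have eq: "icmul B e b = b" using B b by (auto simp: ic_equations_def e_def)
  have eB: "e \<in> icarrier B" using algB b b' by (simp add: ic_algebraD e_def)
  have e0: "e \<noteq> iczero B" using eq b B.l_null[of b] by auto
  have ee: "icmul B e e = e"
    using B.m_assoc[of e b "icinv B b"] eB b b' eq by (simp add: e_def)
  have reg: "\<exists>a'\<in>carrier (ring_of A). a \<otimes>\<^bsub>ring_of A\<^esub> a' \<otimes>\<^bsub>ring_of A\<^esub> a = a"
    if "a \<in> carrier (ring_of A)" for a
    using that A algA by (intro bexI[of _ "icinv A a"]) (auto simp: ic_equations_def ic_algebraD)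
  have inj: "ic_hom A C h2" "inj_on h2 (carrier (ring_of A))"
    using h2 by (auto simp: ic_embedding_def)
  obtain F :: "(('b \<Rightarrow> 'c set) \<Rightarrow> 'b \<Rightarrow> 'c set) set ring" and g1 g2 where F: "field F"
    and g1: "g1 \<in> ring_hom (ring_of B) F" and g2: "g2 \<in> ring_hom (ring_of C) F"
    and agree: "\<And>a. a \<in> carrier (ring_of A) \<Longrightarrow> g1 (h1 a) = g2 (h2 a)" and g1e: "g1 e = \<one>\<^bsub>F\<^esub>"
    and gen: "carrier F = generate_ring F (g1 ` carrier (ring_of B) \<union> g2 ` carrier (ring_of C))"
    by (rule exists_amalgamating_field[OF cr reg ic_hom_ring_hom[OF h1] ic_hom_ring_hom[OF inj(1)] inj(2),
          of e]) (use eB e0 ee in auto)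
  interpret F: field F by (rule F)
  \<comment> \<open>Induction over the generated ring: images of \<open>B\<close> and
    \<open>C\<close> have p-th roots by the root laws, and Frobenius makes the set of p-th powers a
    subring.\<close>
  have "\<exists>y\<in>carrier F. y [^]\<^bsub>F\<^esub> p = x"
    if p: "prime p" and char: "[p] \<cdot>\<^bsub>F\<^esub> \<one>\<^bsub>F\<^esub> = \<zero>\<^bsub>F\<^esub>" and "x \<in> carrier F" for p :: nat and x
    using that(3) unfolding gen
  proof (induction)
    case one
    then show ?case using F.nat_pow_one F.one_closed gen by blast
  next
    case (incl x)
    then consider c where "c \<in> icarrier B" "x = g1 c" | c where "c \<in> icarrier C" "x = g2 c" by auto
    then show ?case
    proof cases
      case 1
      then have r: "icroot B p c \<in> icarrier B" "g1 (icroot B p c) [^]\<^bsub>F\<^esub> p = x"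
        using ring_hom_icroot(1)[OF B F g1 p _ char] ic_algebraD(7)[OF algB p] by auto
      then have "g1 (icroot B p c) \<in> carrier F" using ring_hom_closed[OF g1] by simp
      then show ?thesis using r(2) unfolding gen by blast
    next
      case 2
      then have r: "icroot C p c \<in> icarrier C" "g2 (icroot C p c) [^]\<^bsub>F\<^esub> p = x"
        using ring_hom_icroot(1)[OF C F g2 p _ char] ic_algebraD(7)[OF algC p] by auto
      then have "g2 (icroot C p c) \<in> carrier F" using ring_hom_closed[OF g2] by simp
      then show ?thesis using r(2) unfolding gen by blast
    qed
  next
    case (a_inv x)
    then obtain y where y: "y \<in> carrier F" "y [^]\<^bsub>F\<^esub> p = x" using gen by blast
    \<comment> \<open>Additivity of Frobenius gives (-y)^p = -(y^p) without separating p = 2 from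
      odd p.\<close>
    have "(\<ominus>\<^bsub>F\<^esub> y) [^]\<^bsub>F\<^esub> p \<oplus>\<^bsub>F\<^esub> y [^]\<^bsub>F\<^esub> p = (\<ominus>\<^bsub>F\<^esub> y \<oplus>\<^bsub>F\<^esub> y) [^]\<^bsub>F\<^esub> p"
      using y by (intro F.frobenius_add[symmetric] p char) auto
    also have "\<dots> = \<zero>\<^bsub>F\<^esub>" using y p by (simp add: F.l_neg F.nat_pow_zero prime_gt_0_nat)
    finally have "\<ominus>\<^bsub>F\<^esub> x = (\<ominus>\<^bsub>F\<^esub> y) [^]\<^bsub>F\<^esub> p" using y by (intro F.minus_equality) auto
    then show ?case using y gen by (metis F.a_inv_closed)
  next
    case (eng_add x x')
    then obtain y y' where y: "y \<in> carrier F" "y [^]\<^bsub>F\<^esub> p = x" "y' \<in> carrier F" "y' [^]\<^bsub>F\<^esub> p = x'"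
      using gen by blast
    then have "(y \<oplus>\<^bsub>F\<^esub> y') [^]\<^bsub>F\<^esub> p = x \<oplus>\<^bsub>F\<^esub> x'" using F.frobenius_add[OF p char] by simp
    then show ?case using y gen by (metis F.a_closed)
  next
    case (eng_mult x x')
    then obtain y y' where y: "y \<in> carrier F" "y [^]\<^bsub>F\<^esub> p = x" "y' \<in> carrier F" "y' [^]\<^bsub>F\<^esub> p = x'"
      using gen by blast
    then have "(y \<otimes>\<^bsub>F\<^esub> y') [^]\<^bsub>F\<^esub> p = x \<otimes>\<^bsub>F\<^esub> x'" by (simp add: F.nat_pow_distrib)
    then show ?case using y gen by (metis F.m_closed)
  qed
  then have icf: "implicitly_closed_field (icalg_of F)"
    by (intro implicitly_closed_field_icalg_of F) auto
  have hom: "ic_hom B (icalg_of F) g1" "ic_hom C (icalg_of F) g2"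
    using ring_hom_ic_hom[OF B F g1] ring_hom_ic_hom[OF C F g2] by auto
  have "g1 b \<noteq> \<zero>\<^bsub>F\<^esub>"
  proof
    assume 0: "g1 b = \<zero>\<^bsub>F\<^esub>"
    have "g1 e = g1 b \<otimes>\<^bsub>F\<^esub> g1 (icinv B b)" using ic_homD(5)[OF hom(1) b(1) b'] by (simp add: e_def)
    then have "g1 e = \<zero>\<^bsub>F\<^esub>" using 0 ic_homD(1)[OF hom(1) b'] by simp
    then show False using g1e by simp
  qed
  then show ?thesis using that[OF icf hom] agree by simp
qed

section \<open>Generated subalgebras\<close>

text \<open>Zero and one have no constructors: in the application they are values of generators,
  being images of the constants of \<open>B\<close>.\<close>

datatype 'x ic_term =
  Gen 'x | Plus "'x ic_term" "'x ic_term" | Times "'x ic_term" "'x ic_term" | Neg "'x ic_term" |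
  Inv "'x ic_term" | Root nat "'x ic_term"

text \<open>At a nonprime index \<open>Root\<close> is evaluated as the identity, because
  \<open>ic_closed\<close> promises nothing about \<open>icroot\<close> there.\<close>

primrec ic_eval :: "'p icalg \<Rightarrow> ('x \<Rightarrow> 'p) \<Rightarrow> 'x ic_term \<Rightarrow> 'p" where
  "ic_eval P g (Gen x) = g x"
| "ic_eval P g (Plus s t) = icadd P (ic_eval P g s) (ic_eval P g t)"
| "ic_eval P g (Times s t) = icmul P (ic_eval P g s) (ic_eval P g t)"
| "ic_eval P g (Neg t) = icneg P (ic_eval P g t)"
| "ic_eval P g (Inv t) = icinv P (ic_eval P g t)"
| "ic_eval P g (Root p t) = (if prime p then icroot P p (ic_eval P g t) else ic_eval P g t)"

lemma ic_eval_closed: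
  assumes "ic_algebra P" "\<And>x. g x \<in> icarrier P"
  shows "ic_eval P g t \<in> icarrier P"
  by (induction t) (auto simp: assms ic_algebraD)

lemma ic_closed_range_ic_eval:
  assumes "iczero P \<in> range g" "icone P \<in> range g"
  shows "ic_closed P (range (ic_eval P g))"
proof -
  have g: "g x \<in> range (ic_eval P g)" for x by (metis ic_eval.simps(1) rangeI)
  show ?thesis
    unfolding ic_closed_def
  proof (intro conjI ballI allI impI)
    show "iczero P \<in> range (ic_eval P g)" "icone P \<in> range (ic_eval P g)" using assms g by auto
  next
    fix x y assume "x \<in> range (ic_eval P g)" "y \<in> range (ic_eval P g)"
    then obtain s t where st: "x = ic_eval P g s" "y = ic_eval P g t" by blast
    show "icadd P x y \<in> range (ic_eval P g)" "icmul P x y \<in> range (ic_eval P g)"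
      using rangeI[of "ic_eval P g" "Plus s t"] rangeI[of "ic_eval P g" "Times s t"]
      by (simp_all add: st)
  next
    fix x assume "x \<in> range (ic_eval P g)"
    then obtain t where t: "x = ic_eval P g t" by blast
    show "icneg P x \<in> range (ic_eval P g)" "icinv P x \<in> range (ic_eval P g)"
      using rangeI[of "ic_eval P g" "Neg t"] rangeI[of "ic_eval P g" "Inv t"] by (simp_all add: t)
  next
    fix p :: nat and x assume "prime p" "x \<in> range (ic_eval P g)"
    then obtain t where t: "x = ic_eval P g t" by blast
    show "icroot P p x \<in> range (ic_eval P g)"
      using rangeI[of "ic_eval P g" "Root p t"] \<open>prime p\<close> by (simp add: t)
  qed
qed

text \<open>A self-delimiting unary numeral. \<open>Inl\<close> and \<open>Inr\<close> serve as two
  letters that are distinct whatever \<open>'b\<close> and \<open>'c\<close> are.\<close>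

definition header :: "nat \<Rightarrow> ('b + 'c) list" where
  "header n = replicate n (Inl undefined) @ [Inr undefined]"

lemma header_append_eq: "header m @ r = header n @ s \<longleftrightarrow> m = n \<and> r = s"
proof (induction m arbitrary: n)
  case 0
  then show ?case by (cases n) (auto simp: header_def)
next
  case (Suc m)
  then show ?case by (cases n) (auto simp: header_def)
qed

text \<open>Polish notation, each constructor tagged by its own numeral; the shift by 5 keeps the
  tags of \<open>Root\<close> apart from the others.\<close>

primrec ic_code :: "('b + 'c) ic_term \<Rightarrow> ('b + 'c) list" where
  "ic_code (Gen x) = header 0 @ [x]"
| "ic_code (Plus s t) = header 1 @ ic_code s @ ic_code t"
| "ic_code (Times s t) = header 2 @ ic_code s @ ic_code t"
| "ic_code (Neg t) = header 3 @ ic_code t"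
| "ic_code (Inv t) = header 4 @ ic_code t"
| "ic_code (Root p t) = header (5 + p) @ ic_code t"

text \<open>Unique readability. The tails \<open>u\<close> and \<open>v\<close> make the induction
  work, since the code of a first subterm is followed by that of the second.\<close>

lemma ic_code_append_eq: "ic_code s @ u = ic_code t @ v \<Longrightarrow> s = t \<and> u = v"
proof (induction s arbitrary: t u v)
  case (Gen x)
  then show ?case by (cases t) (auto simp: header_append_eq)
next
  case (Plus s1 s2)
  from Plus.prems show ?case by (cases t) (auto simp: header_append_eq dest!: Plus.IH)
next
  case (Times s1 s2)
  from Times.prems show ?case by (cases t) (auto simp: header_append_eq dest!: Times.IH)
next
  case (Neg s)
  from Neg.prems show ?case by (cases t) (auto simp: header_append_eq dest!: Neg.IH)
next
  case (Inv s)
  from Inv.prems show ?case by (cases t) (auto simp: header_append_eq dest!: Inv.IH)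
next
  case (Root p s)
  from Root.prems show ?case by (cases t) (auto simp: header_append_eq dest!: Root.IH)
qed

lemma inj_ic_code: "inj ic_code"
  using ic_code_append_eq[where u = "[]" and v = "[]"] by (auto simp: inj_def)

text \<open>Renames the elements of a subalgebra \<open>S\<close> by an injection \<open>c\<close>,
  which moves it to another type; each operation decodes, computes in \<open>P\<close> and
  encodes.\<close>

definition ic_transport :: "'p icalg \<Rightarrow> 'p set \<Rightarrow> ('p \<Rightarrow> 'd) \<Rightarrow> 'd icalg" where
  "ic_transport P S c = (let \<phi> = inv_into S c in
    \<lparr> icarrier = c ` S, icadd = (\<lambda>x y. c (icadd P (\<phi> x) (\<phi> y))), icmul = (\<lambda>x y. c (icmul P (\<phi> x) (\<phi> y))),
      icneg = (\<lambda>x. c (icneg P (\<phi> x))), iczero = c (iczero P), icone = c (icone P),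
      icinv = (\<lambda>x. c (icinv P (\<phi> x))), icroot = (\<lambda>p x. c (icroot P p (\<phi> x))) \<rparr>)"

lemma ic_transport:
  assumes S: "S \<subseteq> icarrier P" "ic_closed P S" and c: "inj_on c S"
  shows "ic_algebra (ic_transport P S c)" "ic_embedding (ic_transport P S c) P (inv_into S c)"
    "ic_hom B P g \<Longrightarrow> g ` icarrier B \<subseteq> S \<Longrightarrow> ic_hom B (ic_transport P S c) (c \<circ> g)"
proof -
  note cl = S(2)[unfolded ic_closed_def]
  have inv: "inv_into S c (c x) = x" if "x \<in> S" for x using c that by simp
  show "ic_algebra (ic_transport P S c)"
    unfolding ic_algebra_def ic_closed_def ic_transport_def Let_def using cl by (auto simp: inv)
  show "ic_embedding (ic_transport P S c) P (inv_into S c)"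
    unfolding ic_embedding_def ic_hom_def ic_transport_def Let_def using cl S(1)
    by (auto simp: inv intro!: inj_onI)
  show "ic_hom B (ic_transport P S c) (c \<circ> g)" if g: "ic_hom B P g" "g ` icarrier B \<subseteq> S"
    using g(2) ic_homD[OF g(1)]
    unfolding ic_hom_def ic_transport_def Let_def by (auto simp: inv image_subset_iff)
qed

text \<open>The subalgebra generated by the images of \<open>B\<close> and \<open>C\<close> is the set of values of terms, and terms
  over \<open>'b + 'c\<close> have codes in \<open>('b + 'c) list\<close>.\<close>
lemma exists_generated_subalgebra:
  fixes B :: "'b icalg" and C :: "'c icalg" and P :: "'p icalg"
  assumes P: "ic_algebra P" and B: "ic_algebra B" and g1: "ic_hom B P g1" and g2: "ic_hom C P g2"
  obtains D :: "('b + 'c) list icalg" and \<phi> k1 k2 where "ic_algebra D" "ic_embedding D P \<phi>"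
    "ic_hom B D k1" "ic_hom C D k2"
    "\<And>b. b \<in> icarrier B \<Longrightarrow> \<phi> (k1 b) = g1 b" "\<And>c. c \<in> icarrier C \<Longrightarrow> \<phi> (k2 c) = g2 c"
proof -
  \<comment> \<open>All of \<open>'b + 'c\<close> serves as generators; elements outside the
    carriers go to zero so that every term has its value in \<open>P\<close>.\<close>
  define g where "g = case_sum (\<lambda>b. if b \<in> icarrier B then g1 b else iczero P)
    (\<lambda>c. if c \<in> icarrier C then g2 c else iczero P)"
  define S where "S = range (ic_eval P g)"
  \<comment> \<open>Each value is named by the code of one chosen term for it, so codes of distinct
    values differ.\<close>
  define c where "c x = ic_code (inv_into UNIV (ic_eval P g) x)" for x
  have gP: "g x \<in> icarrier P" for x
    using ic_homD(1)[OF g1] ic_homD(1)[OF g2] ic_algebraD(1)[OF P] by (cases x) (auto simp: g_def)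
  have gB: "g (Inl b) = g1 b" if "b \<in> icarrier B" for b using that by (simp add: g_def)
  have gC: "g (Inr c) = g2 c" if "c \<in> icarrier C" for c using that by (simp add: g_def)
  have gS: "g x \<in> S" for x unfolding S_def by (metis ic_eval.simps(1) rangeI)
  have "iczero P \<in> range g" "icone P \<in> range g"
    using gB[of "iczero B"] gB[of "icone B"] ic_homD(2,3)[OF g1] ic_algebraD(1,2)[OF B] by (metis rangeI)+
  then have cl: "ic_closed P S" unfolding S_def by (rule ic_closed_range_ic_eval)
  have sub: "S \<subseteq> icarrier P" using ic_eval_closed[OF P gP] by (auto simp: S_def)
  have "inj_on c S"
  proof (rule inj_onI)
    fix x y assume xy: "x \<in> S" "y \<in> S" "c x = c y"
    then have "inv_into UNIV (ic_eval P g) x = inv_into UNIV (ic_eval P g) y"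
      unfolding c_def by (blast dest: injD[OF inj_ic_code])
    then show "x = y" using xy(1,2) unfolding S_def by (metis f_inv_into_f)
  qed
  note tr = ic_transport[OF sub cl this]
  have im: "g1 ` icarrier B \<subseteq> S" "g2 ` icarrier C \<subseteq> S" using gS gB gC by (metis image_subsetI)+
  show ?thesis
  proof (rule that[OF tr(1,2) tr(3)[OF g1 im(1)] tr(3)[OF g2 im(2)]])
    show "inv_into S c ((c \<circ> g1) b) = g1 b" if "b \<in> icarrier B" for b
      using that im(1) \<open>inj_on c S\<close> by auto
    show "inv_into S c ((c \<circ> g2) b) = g2 b" if "b \<in> icarrier C" for b
      using that im(2) \<open>inj_on c S\<close> by auto
  qed
qed

text \<open>Closure under the weak inverse makes a subalgebra of a field a field, and closure under
  the weak roots keeps it weakly rooted. This allows a field to be cut down to a generated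
  subalgebra.\<close>

lemma implicitly_closed_field_embedding:
  assumes D: "ic_algebra D" and emb: "ic_embedding D F \<phi>" and F: "implicitly_closed_field F"
  shows "implicitly_closed_field D"
proof -
  have hom: "ic_hom D F \<phi>" and inj: "inj_on \<phi> (icarrier D)" using emb by (auto simp: ic_embedding_def)
  note h = ic_homD[OF hom] ic_hom_natone[OF D hom] ic_hom_pow[OF D hom]
  note clos = ic_algebraD[OF D] ic_natone_closed[OF D] ic_pow_closed[OF D]
  have eqI: "x = y" if "\<phi> x = \<phi> y" "x \<in> icarrier D" "y \<in> icarrier D" for x y
    using inj that by (auto simp: inj_on_def)
  note F' = F[unfolded implicitly_closed_field_def]
  have Ff: "ic_field F" and Fw: "ic_char0 F \<or> (\<exists>p. ic_charp F p)"
    using F' by (auto simp: weakly_rooted_def)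
  have inv: "icinv F x \<in> icarrier F" "x = iczero F \<Longrightarrow> icinv F x = iczero F"
    "x \<noteq> iczero F \<Longrightarrow> icmul F x (icinv F x) = icone F" if "x \<in> icarrier F" for x
    using F' that by blast+
  have root: "if ic_charp F p then ic_pow F (icroot F p x) p = x else icroot F p x = iczero F"
    if "prime p" "x \<in> icarrier F" for p x
    using F' that by blast
  have zero: "\<phi> x = iczero F \<longleftrightarrow> x = iczero D" if "x \<in> icarrier D" for x
    using eqI[of x "iczero D"] that h(2) clos(1) by auto
  have charp: "ic_charp D p \<longleftrightarrow> ic_charp F p" for p
    using zero[OF clos(8)] by (simp add: ic_charp_def h)
  have invD: "x = iczero D \<Longrightarrow> icinv D x = iczero D"
    "x \<noteq> iczero D \<Longrightarrow> icmul D x (icinv D x) = icone D" if x: "x \<in> icarrier D" for x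
    using x inv(2,3)[OF h(1)[OF x]] zero[OF x] by (auto intro!: eqI simp: h clos)
  have rootD: "if ic_charp D p then ic_pow D (icroot D p x) p = x else icroot D p x = iczero D"
    if "prime p" "x \<in> icarrier D" for p x
    using root[OF that(1) h(1)[OF that(2)]] that by (auto intro!: eqI simp: h clos charp split: if_splits)
  have "ic_field D"
    unfolding ic_field_def
  proof (intro conjI ballI impI)
    show "iczero D \<noteq> icone D" using Ff h(2,3) unfolding ic_field_def by metis
    show "\<exists>y\<in>icarrier D. icmul D x y = icone D" if "x \<in> icarrier D" "x \<noteq> iczero D" for x
      using invD(2)[OF that] clos(6)[OF that(1)] by blast
    fix x y assume x: "x \<in> icarrier D" and y: "y \<in> icarrier D"
    show "icadd D x y = icadd D y x" "icmul D x y = icmul D y x"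
      using x y Ff[unfolded ic_field_def] by (auto intro!: eqI simp: h clos)
    fix z assume z: "z \<in> icarrier D"
    show "icadd D (icadd D x y) z = icadd D x (icadd D y z)"
      "icmul D (icmul D x y) z = icmul D x (icmul D y z)"
      "icmul D x (icadd D y z) = icadd D (icmul D x y) (icmul D x z)"
      using x y z Ff[unfolded ic_field_def] by (auto intro!: eqI simp: h clos)
  next
    fix x assume x: "x \<in> icarrier D"
    show "icadd D x (iczero D) = x" "icadd D x (icneg D x) = iczero D" "icmul D x (icone D) = x"
      using x Ff[unfolded ic_field_def] by (auto intro!: eqI simp: h clos)
  qed (auto simp: clos)
  moreover have "ic_char0 D \<or> (\<exists>p. ic_charp D p \<and> (\<forall>a\<in>icarrier D. \<exists>b\<in>icarrier D. ic_pow D b p = a))"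
  proof (cases "ic_char0 F")
    case True
    then show ?thesis using zero[OF clos(8)] by (auto simp: ic_char0_def h)
  next
    case False
    then obtain p where p: "ic_charp D p" using Fw charp by blast
    then have "prime p" by (simp add: ic_charp_def)
    then have "\<forall>a\<in>icarrier D. \<exists>b\<in>icarrier D. ic_pow D b p = a"
      using rootD[OF \<open>prime p\<close>] clos(7)[OF \<open>prime p\<close>] p by (metis (full_types))
    then show ?thesis using p by blast
  qed
  ultimately have "weakly_rooted D" by (simp add: weakly_rooted_def)
  then show ?thesis
    unfolding implicitly_closed_field_def
  proof (intro conjI ballI allI impI)
    show "if ic_charp D p then ic_pow D (icroot D p x) p = x else icroot D p x = iczero D"
      if "prime p" "x \<in> icarrier D" for p x
      using rootD[OF that] .
  qed (simp_all add: invD clos)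
qed

section \<open>Amalgamation\<close>

text \<open>The type of \<open>F\<close> no longer depends on which of \<open>B\<close> and \<open>C\<close> comes first, so that the fields
  separating the points of \<open>B\<close> and those separating the points of \<open>C\<close> enter one product.\<close>
lemma exists_separating_field:
  fixes A :: "'a icalg" and B :: "'b icalg" and C :: "'c icalg"
  assumes A: "ic_equations A" and B: "ic_equations B" and C: "ic_equations C"
    and h1: "ic_embedding A B h1" and h2: "ic_embedding A C h2"
    and x: "x \<in> Inl ` (icarrier B - {iczero B}) \<union> Inr ` (icarrier C - {iczero C})"
  shows "\<exists>(F :: ('b + 'c) list icalg) k1 k2. implicitly_closed_field F \<and> ic_hom B F k1 \<and> ic_hom C F k2 \<and>
    (\<forall>a\<in>icarrier A. k1 (h1 a) = k2 (h2 a)) \<and>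
    (\<forall>b. x = Inl b \<longrightarrow> k1 b \<noteq> iczero F) \<and> (\<forall>c. x = Inr c \<longrightarrow> k2 c \<noteq> iczero F)"
proof -
  have algB: "ic_algebra B" using B by (simp add: ic_equations_def)
  have hom: "ic_hom A B h1" "ic_hom A C h2" using h1 h2 by (auto simp: ic_embedding_def)
  \<comment> \<open>\<open>'f\<close> is arbitrary here because the fact is used at two types, one
    for each order of \<open>B\<close> and \<open>C\<close>.\<close>
  have small: ?thesis if F: "implicitly_closed_field F" and g1: "ic_hom B F g1" and g2: "ic_hom C F g2"
    and agree: "\<And>a. a \<in> icarrier A \<Longrightarrow> g1 (h1 a) = g2 (h2 a)"
    and ne: "\<And>b. x = Inl b \<Longrightarrow> g1 b \<noteq> iczero F" "\<And>c. x = Inr c \<Longrightarrow> g2 c \<noteq> iczero F"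
    for F :: "'f icalg" and g1 g2
  proof -
    have "ic_algebra F" using implicitly_closed_field_equations[OF F] by (simp add: ic_equations_def)
    then obtain D :: "('b + 'c) list icalg" and \<phi> k1 k2 where D: "ic_algebra D" "ic_embedding D F \<phi>"
      "ic_hom B D k1" "ic_hom C D k2"
      and \<phi>: "\<And>b. b \<in> icarrier B \<Longrightarrow> \<phi> (k1 b) = g1 b" "\<And>c. c \<in> icarrier C \<Longrightarrow> \<phi> (k2 c) = g2 c"
      using algB g1 g2 by (rule exists_generated_subalgebra) blast
    have inj: "inj_on \<phi> (icarrier D)" and z: "\<phi> (iczero D) = iczero F"
      using D(2) by (auto simp: ic_embedding_def ic_homD)
    have "k1 (h1 a) = k2 (h2 a)" if "a \<in> icarrier A" for a
      using that inj agree[OF that] \<phi> ic_homD(1)[OF hom(1) that] ic_homD(1)[OF hom(2) that]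
        ic_homD(1)[OF D(3)] ic_homD(1)[OF D(4)] by (metis inj_onD)
    moreover have "k1 b \<noteq> iczero D" if "x = Inl b" for b
    proof -
      have "b \<in> icarrier B" using that x by auto
      then show ?thesis using \<phi>(1)[of b] ne(1)[OF that] z by auto
    qed
    moreover have "k2 c \<noteq> iczero D" if "x = Inr c" for c
    proof -
      have "c \<in> icarrier C" using that x by auto
      then show ?thesis using \<phi>(2)[of c] ne(2)[OF that] z by auto
    qed
    ultimately show ?thesis
      using D implicitly_closed_field_embedding[OF D(1,2) F]
      by (intro exI[of _ D] exI[of _ k1] exI[of _ k2]) blast
  qed
  from x consider b where "x = Inl b" "b \<in> icarrier B" "b \<noteq> iczero B"
    | c where "x = Inr c" "c \<in> icarrier C" "c \<noteq> iczero C" by blast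
  then show ?thesis
  proof cases
    case 1
    obtain F :: "(('b \<Rightarrow> 'c set) \<Rightarrow> 'b \<Rightarrow> 'c set) set icalg" and g1 g2 where
      "implicitly_closed_field F" "ic_hom B F g1" "ic_hom C F g2"
      "\<And>a. a \<in> icarrier A \<Longrightarrow> g1 (h1 a) = g2 (h2 a)" "g1 b \<noteq> iczero F"
      using exists_amalgamating_implicitly_closed_field[OF A B C hom(1) h2 1(2,3)] by blast
    then show ?thesis using 1(1) by (intro small[of F g1 g2]) auto
  next
    case 2
    obtain F :: "(('c \<Rightarrow> 'b set) \<Rightarrow> 'c \<Rightarrow> 'b set) set icalg" and g1 g2 where
      "implicitly_closed_field F" "ic_hom C F g1" "ic_hom B F g2"
      "\<And>a. a \<in> icarrier A \<Longrightarrow> g1 (h2 a) = g2 (h1 a)" "g1 c \<noteq> iczero F"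
      using exists_amalgamating_implicitly_closed_field[OF A C B hom(2) h1 2(2,3)] by blast
    then show ?thesis using 2(1) by (intro small[of F g2 g1]) auto
  qed
qed

section \<open>Products, and embeddings from trivial kernels\<close>

lemma ic_algebra_product:
  assumes "\<And>i. i \<in> I \<Longrightarrow> ic_algebra (F i)"
  shows "ic_algebra (ic_product I F)"
  unfolding ic_algebra_def ic_closed_def ic_product_def
  using ic_algebraD[OF assms] by (auto simp: PiE_iff)

lemma ic_hom_product:
  assumes "\<And>i. i \<in> I \<Longrightarrow> ic_hom B (F i) (k i)"
  shows "ic_hom B (ic_product I F) (\<lambda>b. \<lambda>i\<in>I. k i b)"
  unfolding ic_hom_def ic_product_def
  using ic_homD[OF assms] by (auto cong: restrict_cong)

lemma ic_embedding_of_trivial_kernel: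
  assumes B: "ic_equations B" and D: "ic_equations D" and h: "ic_hom B D h"
    and ker: "\<And>b. b \<in> icarrier B \<Longrightarrow> h b = iczero D \<Longrightarrow> b = iczero B"
  shows "ic_embedding B D h"
proof -
  have cr: "cring (ring_of B)" "cring (ring_of D)" using B D by (auto simp: ic_equations_def)
  interpret h: ring_hom_ring "ring_of B" "ring_of D" h
    using cr ic_hom_ring_hom[OF h] by (intro ring_hom_ringI2) (auto intro: cring.axioms)
  have "{b \<in> icarrier B. h b = iczero D} = {iczero B}"
    using ker ic_homD(2)[OF h] h.R.zero_closed[unfolded ring_of_simps] by blast
  then have "a_kernel (ring_of B) (ring_of D) h = {\<zero>\<^bsub>ring_of B\<^esub>}"
    unfolding a_kernel_def' ring_of_simps .
  then have "inj_on h (carrier (ring_of B))" by (rule h.trivial_ker_imp_inj)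
  then show ?thesis using h by (simp add: ic_embedding_def)
qed

theorem mainTheorem6:
  fixes A :: "'a icalg" and B :: "'b icalg" and C :: "'c icalg"
    and h1 :: "'a \<Rightarrow> 'b" and h2 :: "'a \<Rightarrow> 'c"
  assumes "ICM A TYPE('ia) TYPE('fa)"
    and "ICM B TYPE('ib) TYPE('fb)"
    and "ICM C TYPE('ic) TYPE('fc)"
    and "ic_embedding A B h1"
    and "ic_embedding A C h2"
  shows "\<exists>(D :: ('b + 'c) list icalg) g1 g2.
           ICM D TYPE(('b + 'c) list) TYPE(('b + 'c) list) \<and>
           ic_embedding B D g1 \<and> ic_embedding C D g2 \<and>
           (\<forall>a\<in>icarrier A. g1 (h1 a) = g2 (h2 a))"
proof -
  have A: "ic_equations A" and B: "ic_equations B" and C: "ic_equations C"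
    using assms ICM_equations by blast+
  have algB: "ic_algebra B" using B by (simp add: ic_equations_def)
  define X where "X = Inl ` (icarrier B - {iczero B}) \<union> Inr ` (icarrier C - {iczero C})"
  \<comment> \<open>One field for each nonzero element of \<open>B\<close> or \<open>C\<close>;
    singleton lists bring the indices to the type that the statement prescribes. If both algebras
    are trivial, \<open>I\<close> is empty and the product has one element.\<close>
  define I where "I = (\<lambda>x. [x]) ` X"
  have "\<forall>i\<in>I. \<exists>(F :: ('b + 'c) list icalg) k1 k2. implicitly_closed_field F \<and> ic_hom B F k1 \<and>
      ic_hom C F k2 \<and> (\<forall>a\<in>icarrier A. k1 (h1 a) = k2 (h2 a)) \<and>
      (\<forall>b. i = [Inl b] \<longrightarrow> k1 b \<noteq> iczero F) \<and> (\<forall>c. i = [Inr c] \<longrightarrow> k2 c \<noteq> iczero F)"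
    using exists_separating_field[OF A B C assms(4,5)] unfolding I_def X_def by fastforce
  from bchoice[OF this] obtain F :: "('b + 'c) list \<Rightarrow> ('b + 'c) list icalg" where
    "\<forall>i\<in>I. \<exists>k1 k2. implicitly_closed_field (F i) \<and> ic_hom B (F i) k1 \<and>
      ic_hom C (F i) k2 \<and> (\<forall>a\<in>icarrier A. k1 (h1 a) = k2 (h2 a)) \<and>
      (\<forall>b. i = [Inl b] \<longrightarrow> k1 b \<noteq> iczero (F i)) \<and> (\<forall>c. i = [Inr c] \<longrightarrow> k2 c \<noteq> iczero (F i))" ..
  from bchoice[OF this] obtain k1 where
    "\<forall>i\<in>I. \<exists>k2. implicitly_closed_field (F i) \<and> ic_hom B (F i) (k1 i) \<and>
      ic_hom C (F i) k2 \<and> (\<forall>a\<in>icarrier A. k1 i (h1 a) = k2 (h2 a)) \<and>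
      (\<forall>b. i = [Inl b] \<longrightarrow> k1 i b \<noteq> iczero (F i)) \<and> (\<forall>c. i = [Inr c] \<longrightarrow> k2 c \<noteq> iczero (F i))" ..
  from bchoice[OF this] obtain k2 where all:
    "\<forall>i\<in>I. implicitly_closed_field (F i) \<and> ic_hom B (F i) (k1 i) \<and>
      ic_hom C (F i) (k2 i) \<and> (\<forall>a\<in>icarrier A. k1 i (h1 a) = k2 i (h2 a)) \<and>
      (\<forall>b. i = [Inl b] \<longrightarrow> k1 i b \<noteq> iczero (F i)) \<and> (\<forall>c. i = [Inr c] \<longrightarrow> k2 i c \<noteq> iczero (F i))" ..
  have F: "implicitly_closed_field (F i)" and k: "ic_hom B (F i) (k1 i)" "ic_hom C (F i) (k2 i)"
    and agree: "\<And>a. a \<in> icarrier A \<Longrightarrow> k1 i (h1 a) = k2 i (h2 a)" if "i \<in> I" for i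
    using bspec[OF all that] by simp_all
  have ne: "[Inl b] \<in> I \<Longrightarrow> k1 [Inl b] b \<noteq> iczero (F [Inl b])"
    "[Inr c] \<in> I \<Longrightarrow> k2 [Inr c] c \<noteq> iczero (F [Inr c])" for b c
    using bspec[OF all] by simp_all
  let ?P = "ic_product I F"
  have "ic_algebra ?P"
    using F implicitly_closed_field_equations by (intro ic_algebra_product) (auto simp: ic_equations_def)
  moreover have "ic_hom B ?P (\<lambda>b. \<lambda>i\<in>I. k1 i b)" "ic_hom C ?P (\<lambda>c. \<lambda>i\<in>I. k2 i c)"
    using k by (auto intro: ic_hom_product)
  ultimately obtain D :: "('b + 'c) list icalg" and \<phi> g1 g2 where D: "ic_algebra D" "ic_embedding D ?P \<phi>"
    and g: "ic_hom B D g1" "ic_hom C D g2"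
    and \<phi>: "\<And>b. b \<in> icarrier B \<Longrightarrow> \<phi> (g1 b) = (\<lambda>i\<in>I. k1 i b)"
      "\<And>c. c \<in> icarrier C \<Longrightarrow> \<phi> (g2 c) = (\<lambda>i\<in>I. k2 i c)"
    by (rule exists_generated_subalgebra[OF _ algB]) (rule that)
  have hom\<phi>: "ic_hom D ?P \<phi>" and inj\<phi>: "inj_on \<phi> (icarrier D)" using D(2) by (auto simp: ic_embedding_def)
  have "ic_subalgebra (\<phi> ` icarrier D) ?P"
    unfolding ic_subalgebra_def
  proof
    show "\<phi> ` icarrier D \<subseteq> icarrier ?P" using ic_homD(1)[OF hom\<phi>] by blast
    show "ic_closed ?P (\<phi> ` icarrier D)"
      unfolding ic_closed_def using ic_homD(2-)[OF hom\<phi>, symmetric] ic_algebraD[OF D(1)] by auto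
  qed
  then have ICM: "ICM D TYPE(('b + 'c) list) TYPE(('b + 'c) list)"
    unfolding ICM_def using D(1) F hom\<phi> inj_on_imp_bij_betw[OF inj\<phi>] by blast
  then have Deq: "ic_equations D" by (rule ICM_equations)
  have zero: "\<phi> (iczero D) = (\<lambda>i\<in>I. iczero (F i))" using ic_homD(2)[OF hom\<phi>] by (simp add: ic_product_def)
  have emb1: "ic_embedding B D g1"
  proof (rule ic_embedding_of_trivial_kernel[OF B Deq g(1)], rule ccontr)
    fix b assume b: "b \<in> icarrier B" "g1 b = iczero D" "b \<noteq> iczero B"
    then have i: "[Inl b] \<in> I" by (auto simp: I_def X_def)
    \<comment> \<open>The component indexed by \<open>b\<close> itself belongs to a field in which
      \<open>b\<close> survives.\<close>
    have "(\<lambda>i\<in>I. k1 i b) [Inl b] = (\<lambda>i\<in>I. iczero (F i)) [Inl b]" using \<phi>(1)[OF b(1)] b(2) zero by simp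
    then show False using i ne(1)[OF i] by simp
  qed
  have emb2: "ic_embedding C D g2"
  proof (rule ic_embedding_of_trivial_kernel[OF C Deq g(2)], rule ccontr)
    fix c assume c: "c \<in> icarrier C" "g2 c = iczero D" "c \<noteq> iczero C"
    then have i: "[Inr c] \<in> I" by (auto simp: I_def X_def)
    have "(\<lambda>i\<in>I. k2 i c) [Inr c] = (\<lambda>i\<in>I. iczero (F i)) [Inr c]" using \<phi>(2)[OF c(1)] c(2) zero by simp
    then show False using i ne(2)[OF i] by simp
  qed
  have "g1 (h1 a) = g2 (h2 a)" if a: "a \<in> icarrier A" for a
  proof (rule inj_onD[OF inj\<phi>])
    have h: "h1 a \<in> icarrier B" "h2 a \<in> icarrier C"
      using assms(4,5) a by (auto simp: ic_embedding_def ic_homD)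
    then show "g1 (h1 a) \<in> icarrier D" "g2 (h2 a) \<in> icarrier D" using g by (auto simp: ic_homD)
    \<comment> \<open>\<open>\<phi>\<close> is injective on \<open>D\<close>, so the two maps from
      \<open>A\<close> may be compared in the product, where they agree in every component.\<close>
    show "\<phi> (g1 (h1 a)) = \<phi> (g2 (h2 a))"
      using \<phi> h agree a by (auto cong: restrict_cong)
  qed
  then show ?thesis using ICM emb1 emb2 by blast
qed

end
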